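(* Suppose $\underline z_i=\underline z$ for all $i$, i.e. $\mu_i-c_i$ is the same number $\underline z$ for every box. Then the set $S^*\subset\mathbb R^n\times\mathbb R^n$ of all feasible pairs of search and choice behaviors is a polytope. Moreover, there exists a single feasible CDF profile $F^*$ that induces every pair in $S^*$ (for each $(v,d)\in S^*$ some optimal, possibly mixed, strategy under $F^*$ induces $(v,d)$), such that under $F^*$ the reservation value of every box equals $\underline z$, and Pandora's optimal expected payoff under $F^*$ is the minimum of her optimal expected payoff over all feasible CDF profiles and equals $\underline z$.
   Context: Model. There are $n\ge2$ boxes and a risk-neutral agent, Pandora. Box $i$ contains a reward $x_i$ with prior CDF $F_i^0$ on $[\underline x_i,\overline x_i]$, $0\le\underline x_i<\overline x_i\le1$, with mean $\mu_i$. (A special case is the binary prior on $\{\underline x_i,\overline x_i\}$.) Opening box $i$ costs $c_i>0$, where $c_i<\mu_i-\underline x_i$. Put $\underline z_i=\mu_i-c_i$ and $\underline z=\max_i\underline z_i$. A CDF $F_i$ is feasible for box $i$ iff it is a mean-preserving contraction of $F_i^0$: $\int_{\underline x_i}^{y}F_i(x)dx\le\int_{\underline x_i}^{y}F_i^0(x)dx$ for all $y\in[\underline x_i,\overline x_i]$, with equality at $y=\overline x_i$ (for a binary prior this just says that $F_i$ has mean $\mu_i$). A CDF profile $F=(F_1,\dots,F_n)$ is feasible iff every $F_i$ is. Given $F$, the values $y_i\sim F_i$ are independent across boxes; opening box $i$ (possible at most once) costs $c_i$ and reveals $y_i$. A strategy is a (possibly mixed) sequential decision rule which, at each stage and depending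 on what has been observed, decides whether to stop and, if not, which unopened box to open next; at least one box must be opened (no outside option), and on stopping Pandora chooses one previously opened box. Her payoff is the value of the chosen box minus the total cost of the boxes opened; a strategy is optimal if it maximizes expected payoff. The reservation value of $F_i$ is the unique $z_i$ with $c_i=\int(y-z_i)^+dF_i(y)$. (Optimal strategies are those following Pandora's rule: open unopened boxes in decreasing order of reservation value; stop when the maximal observed value exceeds all reservation values of unopened boxes and then choose the opened box with the highest value; ties broken arbitrarily.) The search behavior of a strategy is $v\in\mathbb R^n$, $v_i$ being the probability that box $i$ is opened; its choice behavior is $d\in\mathbb R^n$, $d_i$ being the probability that box $i$ is eventually chosen. A pair $(v,d)$ is feasible if some feasible CDF profile together with some optimal (possibly mixed) strategy under it induces $v$ as search behavior and $d$ as choice behavior. A point $s\in S$ is a vertex of $S\subset\mathbb R^N$ if some linear functional is uniquely maximized over $S$ at $s$; a set is a polytope if it is the convex hull of its vertices and these are finite in number. *)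

theory Defs
  imports "HOL-Probability.Probability"
begin

definition vertex_of :: "'a::real_vector \<Rightarrow> 'a set \<Rightarrow> bool" where
  "vertex_of s S \<longleftrightarrow>
     s \<in> S \<and> (\<exists>f :: 'a \<Rightarrow> real. linear f \<and> (\<forall>t\<in>S. t \<noteq> s \<longrightarrow> f t < f s))"

text \<open>The library's \<^const>\<open>polytope\<close> asks for the hull of some finite set; here the finite
  set is required to be the set of vertices.\<close>

definition vertex_polytope :: "'a::real_vector set \<Rightarrow> bool" where
  "vertex_polytope S \<longleftrightarrow>
     finite {s. vertex_of s S} \<and> S = convex hull {s. vertex_of s S}"

text \<open>A CDF is represented by the Borel probability measure whose \<^const>\<open>cdf\<close> it is.\<close>

definition distribution_on :: "real measure \<Rightarrow> real \<Rightarrow> real \<Rightarrow> bool" where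
  "distribution_on M a b \<longleftrightarrow> real_distribution M \<and> (AE x in M. x \<in> {a..b})"

definition mean :: "real measure \<Rightarrow> real" where
  "mean M = (LINT x|M. x)"

definition mean_preserving_contraction ::
  "real \<Rightarrow> real \<Rightarrow> real measure \<Rightarrow> real measure \<Rightarrow> bool" where
  "mean_preserving_contraction a b M0 M \<longleftrightarrow>
     distribution_on M a b \<and>
     (\<forall>y\<in>{a..b}. (LBINT x:{a..y}. cdf M x) \<le> (LBINT x:{a..y}. cdf M0 x)) \<and>
     (LBINT x:{a..b}. cdf M x) = (LBINT x:{a..b}. cdf M0 x)"

definition feasible_profile ::
  "('n \<Rightarrow> real) \<Rightarrow> ('n \<Rightarrow> real) \<Rightarrow> ('n \<Rightarrow> real measure) \<Rightarrow> ('n \<Rightarrow> real measure) \<Rightarrow> bool" where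
  "feasible_profile xlo xhi F0 F \<longleftrightarrow>
     (\<forall>i. mean_preserving_contraction (xlo i) (xhi i) (F0 i) (F i))"

definition reservation_value :: "real \<Rightarrow> real measure \<Rightarrow> real" where
  "reservation_value c M = (THE z. c = (LINT y|M. max (y - z) 0))"

text \<open>\<open>Stop i\<close> means: stop searching and choose box \<open>i\<close>. A history lists the boxes opened so
  far, in the order of opening, together with the values revealed.\<close>

datatype 'n action = Open 'n | Stop 'n

type_synonym 'n history = "('n \<times> real) list"
type_synonym 'n rule = "'n history \<Rightarrow> 'n action"

text \<open>A mixed strategy is a randomization device (a distribution on the reals) together with a
  decision rule for each of its outcomes.\<close>

type_synonym 'n strategy = "real measure \<times> (real \<Rightarrow> 'n rule)"

definition history_of :: "('n \<Rightarrow> real) \<Rightarrow> 'n list \<Rightarrow> 'n history" where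
  "history_of y os = map (\<lambda>i. (i, y i)) os"

text \<open>The empty history forces a box to be opened; a history listing all boxes forces a stop.\<close>

definition admissible_rule :: "'n rule \<Rightarrow> bool" where
  "admissible_rule r \<longleftrightarrow>
     (\<forall>h. distinct (map fst h) \<longrightarrow>
        r h \<in> Open ` (- (fst ` set h)) \<union> Stop ` (fst ` set h))"

definition is_strategy :: "'n::finite strategy \<Rightarrow> bool" where
  "is_strategy \<sigma> \<longleftrightarrow> (case \<sigma> of (U, s) \<Rightarrow>
     real_distribution U \<and>
     (\<forall>u. admissible_rule (s u)) \<and>
     (\<forall>os. distinct os \<longrightarrow>
        (\<lambda>(u, y). s u (history_of y os))
          \<in> (borel \<Otimes>\<^sub>M (\<Pi>\<^sub>M i\<in>UNIV. borel)) \<rightarrow>\<^sub>M count_space UNIV))"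

text \<open>The boxes opened in the first \<open>k\<close> stages, in order, when the values are \<open>y\<close>. An admissible
  rule has stopped after \<open>CARD('n)\<close> stages.\<close>

primrec explore :: "'n rule \<Rightarrow> ('n \<Rightarrow> real) \<Rightarrow> nat \<Rightarrow> 'n list" where
  "explore r y 0 = []"
| "explore r y (Suc k) =
     (case r (history_of y (explore r y k)) of
        Open j \<Rightarrow> explore r y k @ [j]
      | Stop j \<Rightarrow> explore r y k)"

definition opened :: "'n::finite rule \<Rightarrow> ('n \<Rightarrow> real) \<Rightarrow> 'n list" where
  "opened r y = explore r y CARD('n)"

definition chosen :: "'n::finite rule \<Rightarrow> ('n \<Rightarrow> real) \<Rightarrow> 'n" where
  "chosen r y = (THE j. r (history_of y (opened r y)) = Stop j)"

text \<open>The joint law of the outcome of the randomization device and the independent values.\<close>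

definition outcome_space ::
  "('n::finite \<Rightarrow> real measure) \<Rightarrow> 'n strategy \<Rightarrow> (real \<times> ('n \<Rightarrow> real)) measure" where
  "outcome_space F \<sigma> = fst \<sigma> \<Otimes>\<^sub>M (\<Pi>\<^sub>M i\<in>UNIV. F i)"

definition payoff :: "('n::finite \<Rightarrow> real) \<Rightarrow> ('n \<Rightarrow> real measure) \<Rightarrow> 'n strategy \<Rightarrow> real" where
  "payoff c F \<sigma> =
     (LINT (u, y)|outcome_space F \<sigma>.
        y (chosen (snd \<sigma> u) y) - (\<Sum>i\<in>set (opened (snd \<sigma> u) y). c i))"

definition optimal_strategy ::
  "('n::finite \<Rightarrow> real) \<Rightarrow> ('n \<Rightarrow> real measure) \<Rightarrow> 'n strategy \<Rightarrow> bool" where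
  "optimal_strategy c F \<sigma> \<longleftrightarrow>
     is_strategy \<sigma> \<and> (\<forall>\<tau>. is_strategy \<tau> \<longrightarrow> payoff c F \<tau> \<le> payoff c F \<sigma>)"

definition optimal_payoff :: "('n::finite \<Rightarrow> real) \<Rightarrow> ('n \<Rightarrow> real measure) \<Rightarrow> real" where
  "optimal_payoff c F = (SUP \<sigma>\<in>{\<sigma>. is_strategy \<sigma>}. payoff c F \<sigma>)"

definition search_behavior :: "('n::finite \<Rightarrow> real measure) \<Rightarrow> 'n strategy \<Rightarrow> real ^ 'n" where
  "search_behavior F \<sigma> =
     (\<chi> i. \<P>(w in outcome_space F \<sigma>. i \<in> set (opened (snd \<sigma> (fst w)) (snd w))))"

definition choice_behavior :: "('n::finite \<Rightarrow> real measure) \<Rightarrow> 'n strategy \<Rightarrow> real ^ 'n" where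
  "choice_behavior F \<sigma> =
     (\<chi> i. \<P>(w in outcome_space F \<sigma>. chosen (snd \<sigma> (fst w)) (snd w) = i))"

definition induces ::
  "('n::finite \<Rightarrow> real) \<Rightarrow> ('n \<Rightarrow> real measure) \<Rightarrow> (real ^ 'n) \<times> (real ^ 'n) \<Rightarrow> bool" where
  "induces c F p \<longleftrightarrow>
     (\<exists>\<sigma>. optimal_strategy c F \<sigma> \<and> p = (search_behavior F \<sigma>, choice_behavior F \<sigma>))"

definition feasible_pairs ::
  "('n::finite \<Rightarrow> real) \<Rightarrow> ('n \<Rightarrow> real) \<Rightarrow> ('n \<Rightarrow> real measure) \<Rightarrow> ('n \<Rightarrow> real)
     \<Rightarrow> ((real ^ 'n) \<times> (real ^ 'n)) set" where
  "feasible_pairs xlo xhi F0 c = {p. \<exists>F. feasible_profile xlo xhi F0 F \<and> induces c F p}"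

end

theory Submission
  imports Defs
begin

text \<open>Let \<open>\<phi>\<close> be the stop-loss transform \<open>t \<mapsto> E (y - t)\<^sup>+\<close> of the prior of a box and \<open>c\<close> its cost. Among the
  contractions living on \<open>{z..}\<close> the one with the largest atom at \<open>z\<close> has two points, \<open>z\<close> and
  \<open>z + c / p\<close>, where \<open>p\<close> is the supremum of \<open>(c - \<phi> t) / (t - z)\<close>; this is the optimal profile.
  Convexity shows that under every contraction the value exceeds the reservation value
  \<open>\<zeta> \<ge> z\<close> with probability at least \<open>p\<close>.

  For every strategy the payoff is the expectation of \<open>max\<^sub>i min (y i) (\<zeta> i)\<close> minus a nonnegative
  slack, and Pandora's rule has no slack. Hence an optimal strategy stops and chooses a box as soon as
  its value exceeds its cutoff, which at box \<open>i\<close> happens with probability at least \<open>p i\<close>. Under the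
  optimal profile the probability is exactly \<open>p i\<close>, all other values equal \<open>z\<close>, and continuing, stopping
  and recall are all optimal after them. A dynamic program then bounds every linear functional of the
  behavior by its value at a deterministic plan (an order of opening and a final choice), so the feasible
  pairs are the convex hull of the finitely many plans, and mixtures of plans realize all of them.\<close>

subsection \<open>Stop-loss transforms and two-point contractions\<close>

text \<open>The feasible pairs come from all feasible profiles, yet a single profile has to
  reproduce them. A monotonicity makes this possible: after opening box \<open>j\<close> a plan may
  still stop at once and choose \<open>j\<close>, with the same outcome as a success at
  \<open>j\<close>. So the best continuation after a failure is never worse than a success, and
  lowering the success probability can only raise the maximum of a linear functional. The profile
  with the least success probabilities thus has the largest set of behaviors. The least probability
  is a supremum of slopes because the transform of a contraction is convex, equals \<open>c\<close>
  at its cutoff, has there as right slope minus the probability of exceeding the cutoff, and must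
  stay below \<open>\<phi>\<close>. That mean minus cost is the same for all boxes lets all cutoffs
  be put at one \<open>z\<close> with no value below it. The capped values
  \<open>min (y i) z\<close> are then constant, so every order of opening and every choice after
  failures is optimal. The payoff \<open>z\<close> is minimal since under each feasible profile the
  capped value of every box has mean \<open>z\<close>.\<close>

lemma integral_cdf_eq:
  assumes M: "distribution_on M a b" and "a \<le> y"
  shows "(LBINT x:{a..y}. cdf M x) = (LINT x|M. max (y - x) 0)"
proof -
  interpret real_distribution M using M by (simp add: distribution_on_def)
  have aeM: "AE x in M. a \<le> x" using M by (auto simp: distribution_on_def elim: eventually_mono)
  interpret P: pair_sigma_finite lborel M by standard
  have meas: "(\<lambda>(x, w). indicator {a..y} x * indicator {..x} w :: ennreal) \<in> borel_measurable (lborel \<Otimes>\<^sub>M M)"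
  proof -
    have "(\<lambda>(x, w). indicator {a..y} x * indicator {..x} w :: ennreal) =
       (\<lambda>p. if fst p \<in> {a..y} \<and> snd p \<le> fst p then 1 else 0)"
      by (auto simp: fun_eq_iff indicator_def)
    also have "\<dots> \<in> borel_measurable (borel \<Otimes>\<^sub>M borel)" by measurable
    finally show ?thesis
      by (simp add: measurable_cong_sets[OF sets_pair_measure_cong[OF sets_lborel events_eq_borel] refl])
  qed
  have mono_cdf: "cdf M \<in> borel_measurable borel"
    by (intro borel_measurable_mono monoI cdf_nondecreasing)
  have "(\<integral>\<^sup>+x. ennreal (indicator {a..y} x *\<^sub>R cdf M x) \<partial>lborel)
     = (\<integral>\<^sup>+x. (\<integral>\<^sup>+w. indicator {a..y} x * indicator {..x} w \<partial>M) \<partial>lborel)"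
    by (intro nn_integral_cong)
       (auto simp: cdf_def emeasure_eq_measure nn_integral_cmult_indicator split: split_indicator)
  \<comment> \<open>Tonelli, the CDF having been written as the mass of the \<open>w\<close> with
    \<open>w \<le> x\<close>. The support bound \<open>a \<le> w\<close> then identifies the inner
    set as \<open>{w..y}\<close>.\<close>
  also have "\<dots> = (\<integral>\<^sup>+w. (\<integral>\<^sup>+x. indicator {a..y} x * indicator {..x} w \<partial>lborel) \<partial>M)"
    using P.Fubini[OF meas] by simp
  also have "\<dots> = (\<integral>\<^sup>+w. ennreal (max (y - w) 0) \<partial>M)"
  proof (rule nn_integral_cong_AE, use aeM in eventually_elim)
    fix w assume "a \<le> w"
    have "(\<integral>\<^sup>+x. indicator {a..y} x * indicator {..x} w \<partial>lborel) = (\<integral>\<^sup>+x. indicator {w..y} x \<partial>lborel)"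
      using \<open>a \<le> w\<close> by (intro nn_integral_cong) (auto simp: indicator_def)
    also have "\<dots> = ennreal (max (y - w) 0)"
      by (cases "w \<le> y") (auto simp: max_def)
    finally show "(\<integral>\<^sup>+x. indicator {a..y} x * indicator {..x} w \<partial>lborel) = ennreal (max (y - w) 0)" .
  qed
  finally have eq: "(\<integral>\<^sup>+x. ennreal (indicator {a..y} x *\<^sub>R cdf M x) \<partial>lborel) = (\<integral>\<^sup>+w. ennreal (max (y - w) 0) \<partial>M)" .
  have "(LBINT x:{a..y}. cdf M x) = enn2real (\<integral>\<^sup>+x. ennreal (indicator {a..y} x *\<^sub>R cdf M x) \<partial>lborel)"
    unfolding set_lebesgue_integral_def
    using mono_cdf by (intro integral_eq_nn_integral) (auto simp: cdf_nonneg)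
  also have "\<dots> = (LINT x|M. max (y - x) 0)"
    unfolding eq by (intro integral_eq_nn_integral[symmetric]) auto
  finally show ?thesis .
qed

lemma distribution_on_integrable:
  assumes M: "distribution_on M a b"
  shows "integrable M (\<lambda>x. x)" "integrable M (\<lambda>x. max (x - t) 0)" "integrable M (\<lambda>x. max (t - x) 0)"
proof -
  interpret real_distribution M using M by (simp add: distribution_on_def)
  have ae: "AE x in M. x \<in> {a..b}" using M by (simp add: distribution_on_def)
  show i: "integrable M (\<lambda>x. x)"
  proof (rule integrable_const_bound[where B="\<bar>a\<bar> + \<bar>b\<bar>"])
    show "AE x in M. norm x \<le> \<bar>a\<bar> + \<bar>b\<bar>" using ae by eventually_elim auto
  qed simp
  show "integrable M (\<lambda>x. max (x - t) 0)" "integrable M (\<lambda>x. max (t - x) 0)"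
    by (intro integrable_max Bochner_Integration.integrable_diff integrable_const i integrable_zero)+
qed

text \<open>Put-call parity: it converts integrated CDFs, which are expectations of
  \<open>max (t - x) 0\<close>, into stop-loss transforms.\<close>

lemma integral_pos_part_eq:
  assumes M: "distribution_on M a b"
  shows "(LINT x|M. max (x - t) 0) = mean M - t + (LINT x|M. max (t - x) 0)"
proof -
  interpret real_distribution M using M by (simp add: distribution_on_def)
  note i = distribution_on_integrable[OF M]
  have "(LINT x|M. max (x - t) 0) = (LINT x|M. (x - t) + max (t - x) 0)"
    by (intro Bochner_Integration.integral_cong) auto
  also have "\<dots> = mean M - t + (LINT x|M. max (t - x) 0)"
    using i prob_space by (simp add: mean_def)
  finally show ?thesis .
qed

lemma integral_pos_part_upper:
  assumes M: "distribution_on M a b"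
  shows "(LINT x|M. max (b - x) 0) = b - mean M" "(LINT x|M. max (x - b) 0) = 0"
proof -
  interpret real_distribution M using M by (simp add: distribution_on_def)
  have ae: "AE x in M. x \<in> {a..b}" using M by (simp add: distribution_on_def)
  have "(LINT x|M. max (x - b) 0) = (LINT x|M. 0)"
  proof (rule integral_cong_AE)
    show "AE x in M. max (x - b) 0 = 0" using ae by eventually_elim auto
  qed auto
  then show "(LINT x|M. max (x - b) 0) = 0" by simp
  then show "(LINT x|M. max (b - x) 0) = b - mean M"
    using integral_pos_part_eq[OF M, of b] by simp
qed

text \<open>At \<open>y = b\<close> the integrated CDF is \<open>b\<close> minus the mean, so the
  equality in the definition says that the means agree; parity then turns the inequalities into
  inequalities of stop-loss transforms.\<close>

lemma mean_preserving_contraction_iff: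
  assumes M0: "distribution_on M0 a b" and "a \<le> b"
  shows "mean_preserving_contraction a b M0 M \<longleftrightarrow>
     distribution_on M a b \<and> mean M = mean M0 \<and>
     (\<forall>y\<in>{a..b}. (LINT x|M. max (x - y) 0) \<le> (LINT x|M0. max (x - y) 0))"
proof (cases "distribution_on M a b")
  case True
  have "mean_preserving_contraction a b M0 M \<longleftrightarrow>
     (\<forall>y\<in>{a..b}. (LINT x|M. max (y - x) 0) \<le> (LINT x|M0. max (y - x) 0)) \<and> mean M = mean M0"
    using True assms by (simp add: mean_preserving_contraction_def integral_cdf_eq[OF True]
        integral_cdf_eq[OF M0] integral_pos_part_upper(1)[OF True] integral_pos_part_upper(1)[OF M0])
  then show ?thesis
    using True integral_pos_part_eq[OF True] integral_pos_part_eq[OF M0] by auto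
qed (simp add: mean_preserving_contraction_def)

text \<open>Convexity of the stop-loss transform: \<open>- measure M {s<..}\<close> is its right
  derivative at \<open>s\<close>. The inequality already holds pointwise under the integral.\<close>

lemma pos_part_tangent:
  assumes M: "distribution_on M a b"
  shows "(LINT x|M. max (x - s) 0) - (t - s) * measure M {s<..} \<le> (LINT x|M. max (x - t) 0)"
proof -
  interpret real_distribution M using M by (simp add: distribution_on_def)
  note i = distribution_on_integrable[OF M]
  have "(LINT x|M. max (x - s) 0) - (t - s) * measure M {s<..} =
        (LINT x|M. max (x - s) 0 - (t - s) * indicator {s<..} x)"
    by (subst Bochner_Integration.integral_diff)
       (use i in \<open>auto simp: emeasure_eq_measure\<close>)
  also have "\<dots> \<le> (LINT x|M. max (x - t) 0)"
  proof (rule integral_mono)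
    show "integrable M (\<lambda>x. max (x - s) 0 - (t - s) * indicator {s<..} x)"
      using i by (intro Bochner_Integration.integrable_diff integrable_mult_right) (auto simp: emeasure_eq_measure)
  qed (use i in \<open>auto simp: indicator_def\<close>)
  finally show ?thesis .
qed

lemma mean_bounds:
  assumes M: "distribution_on M a b"
  shows "a \<le> mean M" "mean M \<le> b"
proof -
  interpret real_distribution M using M by (simp add: distribution_on_def)
  have ae: "AE x in M. a \<le> x" "AE x in M. x \<le> b" using M by (auto simp: distribution_on_def)
  show "a \<le> mean M" unfolding mean_def
    using integral_ge_const[OF distribution_on_integrable(1)[OF M] ae(1)] .
  show "mean M \<le> b" unfolding mean_def
    using integral_le_const[OF distribution_on_integrable(1)[OF M] ae(2)] .
qed

lemma pos_part_antimono:
  assumes M: "distribution_on M a b" and "s \<le> t"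
  shows "(LINT x|M. max (x - t) 0) \<le> (LINT x|M. max (x - s) 0)"
  by (rule integral_mono) (use distribution_on_integrable[OF M] \<open>s \<le> t\<close> in auto)

lemma pos_part_nonneg: "0 \<le> (LINT x|M. max (x - t) (0::real))"
  by (rule integral_nonneg_AE) simp

lemma pos_part_ge:
  assumes M: "distribution_on M a b"
  shows "mean M - t \<le> (LINT x|M. max (x - t) 0)"
  using integral_pos_part_eq[OF M, of t] integral_nonneg_AE[of "\<lambda>x. max (t - x) 0" M] by simp

text \<open>Intermediate value theorem: the transform is 1-Lipschitz, at least
  \<open>mean M - z\<close> at \<open>z\<close>, and zero at \<open>b\<close>. Starting at
  \<open>z\<close> yields \<open>z \<le> \<zeta>\<close>, on which \<open>success_prob_least\<close>
  relies.\<close>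

lemma reservation_value_exists:
  assumes M: "distribution_on M a b" and "c \<le> mean M - z" "0 \<le> c" "z \<le> b"
  obtains \<zeta> where "z \<le> \<zeta>" "\<zeta> \<le> b" "c = (LINT x|M. max (x - \<zeta>) 0)"
proof -
  interpret real_distribution M using M by (simp add: distribution_on_def)
  let ?f = "\<lambda>t. LINT x|M. max (x - t) 0"
  have lip: "\<bar>?f s - ?f t\<bar> \<le> \<bar>s - t\<bar>" for s t
  proof -
    have "\<bar>?f s - ?f t\<bar> = \<bar>LINT x|M. max (x - s) 0 - max (x - t) 0\<bar>"
      using distribution_on_integrable[OF M] by simp
    also have "\<dots> \<le> (LINT x|M. \<bar>s - t\<bar>)"
      by (rule order_trans[OF integral_abs_bound], rule integral_mono)
         (use distribution_on_integrable[OF M] in auto)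
    also have "\<dots> = \<bar>s - t\<bar>" using prob_space by simp
    finally show ?thesis .
  qed
  have cont: "continuous_on {z..b} ?f"
    unfolding continuous_on_iff dist_real_def
    using lip by (meson order_le_less_trans)
  have "\<exists>\<zeta>\<ge>z. \<zeta> \<le> b \<and> ?f \<zeta> = c"
    by (rule IVT2'[OF _ _ _ cont])
       (use assms pos_part_ge[OF M, of z] integral_pos_part_upper(2)[OF M] in auto)
  then show ?thesis using that by auto
qed

text \<open>The largest slope of a line that starts at height \<open>mean M - z\<close> above \<open>z\<close>, descends, and
  stays below the stop-loss transform of \<open>M\<close> on \<open>{z<..b}\<close>: the least probability of exceeding \<open>z\<close>
  among the contractions of \<open>M\<close> that live above \<open>z\<close>.\<close>

definition success_prob :: "real measure \<Rightarrow> real \<Rightarrow> real \<Rightarrow> real" where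
  "success_prob M b z = (SUP t\<in>{z<..b}. (mean M - z - (LINT x|M. max (x - t) 0)) / (t - z))"

lemma success_prob_bounds:
  assumes M: "distribution_on M a b" and "z < mean M"
  shows success_prob_ge:
      "\<And>t. t \<in> {z<..b} \<Longrightarrow> mean M - z - (LINT x|M. max (x - t) 0) \<le> success_prob M b z * (t - z)"
    and success_prob_pos: "0 < success_prob M b z"
    and success_prob_le_1: "success_prob M b z \<le> 1"
proof -
  let ?r = "\<lambda>t. (mean M - z - (LINT x|M. max (x - t) 0)) / (t - z)"
  have "z < b" using mean_bounds[OF M] \<open>z < mean M\<close> by simp
  have le1: "?r t \<le> 1" if "t \<in> {z<..b}" for t
    using that pos_part_ge[OF M, of t] by (simp add: divide_simps)
  have bdd: "bdd_above (?r ` {z<..b})" using le1 by (intro bdd_aboveI2)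
  have up: "?r t \<le> success_prob M b z" if "t \<in> {z<..b}" for t
    unfolding success_prob_def by (rule cSUP_upper[OF that bdd])
  show "mean M - z - (LINT x|M. max (x - t) 0) \<le> success_prob M b z * (t - z)" if "t \<in> {z<..b}" for t
    using up[OF that] that by (simp add: divide_simps)
  show "success_prob M b z \<le> 1"
    unfolding success_prob_def using \<open>z < b\<close> le1 by (intro cSUP_least) auto
  \<comment> \<open>Positivity comes from the right end, where the transform vanishes.\<close>
  have "0 < ?r b" using \<open>z < b\<close> \<open>z < mean M\<close> integral_pos_part_upper(2)[OF M] by simp
  also have "\<dots> \<le> success_prob M b z" using up[of b] \<open>z < b\<close> by simp
  finally show "0 < success_prob M b z" .
qed

text \<open>The tangent to the transform of \<open>M\<close> at \<open>\<zeta>\<close> has height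
  \<open>mean M0 - z\<close> and slope minus the success probability, and stays below the transform
  of \<open>M0\<close>. The line of the same height and slope started at
  \<open>z \<le> \<zeta>\<close> is lower still, so the probability bounds every quotient in the
  supremum.\<close>

lemma success_prob_least:
  assumes M0: "distribution_on M0 a b" and "a \<le> z" "z < mean M0"
    and M: "mean_preserving_contraction a b M0 M"
    and "z \<le> \<zeta>" and \<zeta>: "mean M0 - z = (LINT x|M. max (x - \<zeta>) 0)"
  shows "success_prob M0 b z \<le> measure M {\<zeta><..}"
  unfolding success_prob_def
proof (rule cSUP_least)
  show "{z<..b} \<noteq> {}" using mean_bounds[OF M0] \<open>z < mean M0\<close> by simp
  have "a \<le> b" using mean_bounds[OF M0] by simp
  fix t assume t: "t \<in> {z<..b}"
  note mpc = M[unfolded mean_preserving_contraction_iff[OF M0 \<open>a \<le> b\<close>]]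
  have le: "(LINT x|M. max (x - t) 0) \<le> (LINT x|M0. max (x - t) 0)"
    using mpc t \<open>a \<le> z\<close> by auto
  have "mean M0 - z - (LINT x|M0. max (x - t) 0) \<le> measure M {\<zeta><..} * (t - z)"
  proof (cases "t \<le> \<zeta>")
    case True
    \<comment> \<open>Left of the cutoff the transform is still at least \<open>mean M0 - z\<close>,
      so the quotient is not positive.\<close>
    then have "mean M0 - z \<le> (LINT x|M0. max (x - t) 0)"
      using le pos_part_antimono[of M a b t \<zeta>] mpc \<zeta> by auto
    then show ?thesis using t by (smt (verit) greaterThanAtMost_iff measure_nonneg mult_nonneg_nonneg)
  next
    case False
    have "(t - \<zeta>) * measure M {\<zeta><..} \<le> (t - z) * measure M {\<zeta><..}"
      using \<open>z \<le> \<zeta>\<close> by (intro mult_right_mono) auto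
    then show ?thesis using pos_part_tangent[of M a b \<zeta> t] mpc le \<zeta> by (simp add: mult.commute)
  qed
  then show "(mean M0 - z - (LINT x|M0. max (x - t) 0)) / (t - z) \<le> measure M {\<zeta><..}"
    using t by (simp add: divide_simps)
qed

definition two_point :: "real \<Rightarrow> real \<Rightarrow> real \<Rightarrow> real measure" where
  "two_point p x0 x1 = distr (measure_pmf (bernoulli_pmf p)) borel (\<lambda>b. if b then x1 else x0)"

lemma real_distribution_two_point: "real_distribution (two_point p x0 x1)"
  unfolding two_point_def by (rule prob_space.real_distribution_distr[OF measure_pmf.prob_space_axioms]) simp

lemma integral_two_point:
  assumes "f \<in> borel_measurable borel" "0 \<le> p" "p \<le> 1"
  shows "(LINT x|two_point p x0 x1. f x) = f x1 * p + f x0 * (1 - p :: real)"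
  unfolding two_point_def using assms by (subst integral_distr) auto

lemma AE_two_point: "P x0 \<Longrightarrow> P x1 \<Longrightarrow> Measurable.pred borel P \<Longrightarrow> AE x in two_point p x0 x1. P x"
  unfolding two_point_def by (subst AE_distr_iff) (auto simp: pred_def)

text \<open>Above \<open>z\<close> the transform of the two-point law is the positive part of a line
  of slope \<open>- p\<close> that starts at height \<open>mean M - z\<close>, and the choice of
  \<open>p\<close> keeps it below the transform of \<open>M\<close>. Up to \<open>z\<close> it is
  \<open>mean M - y\<close>, the least value that any law with this mean allows.\<close>

lemma two_point_contraction:
  assumes M: "distribution_on M a b" and z: "a \<le> z" "z < mean M"
  defines "p \<equiv> success_prob M b z"
  shows "mean_preserving_contraction a b M (two_point p z (z + (mean M - z) / p))"
proof -
  have p: "0 < p" "p \<le> 1" using success_prob_pos[OF M z(2)] success_prob_le_1[OF M z(2)] by (auto simp: p_def)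
  have "z < b" using mean_bounds[OF M] z by simp
  let ?x = "z + (mean M - z) / p"
  let ?F = "two_point p z ?x"
  \<comment> \<open>The quotient at \<open>t = b\<close>; it keeps the upper atom inside the
    support.\<close>
  have "mean M - z \<le> p * (b - z)"
    using success_prob_ge[OF M z(2), of b] \<open>z < b\<close> integral_pos_part_upper(2)[OF M] by (simp add: p_def)
  then have x: "z \<le> ?x" "?x \<le> b" using p z by (auto simp: field_simps)
  have d: "distribution_on ?F a b"
    unfolding distribution_on_def using x z real_distribution_two_point
    by (intro conjI AE_two_point) auto
  have m: "mean ?F = mean M"
    unfolding mean_def[of ?F] using p by (subst integral_two_point) (auto simp: field_simps)
  have "(LINT x|?F. max (x - y) 0) \<le> (LINT x|M. max (x - y) 0)" if "y \<in> {a..b}" for y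
  proof (cases "y \<le> z")
    case True
    then have "(LINT x|?F. max (x - y) 0) = mean ?F - y"
      using x p True unfolding mean_def
      by (subst (1 2) integral_two_point) (auto simp: max_def algebra_simps)
    then show ?thesis using m pos_part_ge[OF M, of y] by simp
  next
    case False
    then have "(LINT x|?F. max (x - y) 0) = max (p * (?x - y)) 0"
      using p max_mult_distrib_left[of p "?x - y" 0] by (simp add: integral_two_point mult.commute)
    also have "p * (?x - y) = mean M - z - p * (y - z)" using p by (simp add: field_simps)
    finally show ?thesis
      using success_prob_ge[OF M z(2), of y] False that pos_part_nonneg[of M y] by (simp add: p_def)
  qed
  with d m show ?thesis using \<open>z < b\<close> z by (subst mean_preserving_contraction_iff[OF M]) auto
qed

text \<open>The transform of the two-point law is strictly decreasing while positive, so it takes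
  the positive value \<open>c\<close> only once and the definite description in
  \<open>reservation_value\<close> evaluates to \<open>z\<close>.\<close>

lemma two_point_reservation:
  assumes "0 < p" "p \<le> 1" "0 < c"
  shows "c = (LINT y|two_point p z (z + c / p). max (y - z) 0)"
    and "reservation_value c (two_point p z (z + c / p)) = z"
    and "measure (two_point p z (z + c / p)) {z<..} = p"
proof -
  let ?F = "two_point p z (z + c / p)"
  have eq: "(LINT y|?F. max (y - t) 0) = max (z + c / p - t) 0 * p + max (z - t) 0 * (1 - p)" for t
    using assms by (simp add: integral_two_point)
  show *: "c = (LINT y|?F. max (y - z) 0)" using assms unfolding eq by simp
  have "t = z" if "c = (LINT y|?F. max (y - t) 0)" for t
  proof (rule ccontr)
    assume "t \<noteq> z"
    then consider "t < z" | "t > z" by linarith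
    then show False
    proof cases
      case 1
      moreover have "0 < c / p" using assms by simp
      ultimately have "c = (z + c / p - t) * p + (z - t) * (1 - p)" using that[unfolded eq] by simp
      also have "\<dots> = (z - t) + c" using assms by (simp add: field_simps)
      finally have "c = (z - t) + c" .
      with 1 show False by simp
    next
      case 2
      show False
      proof (cases "z + c / p \<le> t")
        case True
        then show False using that[unfolded eq] 2 assms by simp
      next
        case False
        then have "c = (z - t) * p + c" using that[unfolded eq] 2 assms by (simp add: max_def field_simps)
        with 2 assms show False by simp
      qed
    qed
  qed
  then show "reservation_value c ?F = z" unfolding reservation_value_def
    using * by (intro the_equality) auto
  have "measure ?F {z<..} = (LINT y|?F. indicator {z<..} y)"
    by (simp add: two_point_def)
  also have "\<dots> = p" using assms by (subst integral_two_point) auto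
  finally show "measure ?F {z<..} = p" .
qed

subsection \<open>Runs of a rule\<close>

lemma fst_history_of [simp]: "map fst (history_of y os) = os" "fst ` set (history_of y os) = set os"
  by (auto simp: history_of_def o_def image_image)

lemma history_of_cong: "(\<And>i. i \<in> set os \<Longrightarrow> y i = y' i) \<Longrightarrow> history_of y os = history_of y' os"
  by (auto simp: history_of_def)

lemma explore_mono: "k \<le> l \<Longrightarrow> set (explore r y k) \<subseteq> set (explore r y l)"
  by (induction l rule: dec_induct) (auto split: action.splits)

text \<open>Non-anticipation: only the values of boxes already opened enter a history.\<close>

lemma explore_cong:
  "(\<And>i. i \<in> set (explore r y k) \<Longrightarrow> y' i = y i) \<Longrightarrow> explore r y' k = explore r y k"
proof (induction k)
  case (Suc k)
  have "explore r y' k = explore r y k"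
    using Suc explore_mono[of k "Suc k" r y] by (meson le_SucI order_refl subsetD)
  moreover have "history_of y' (explore r y k) = history_of y (explore r y k)"
    using Suc.prems explore_mono[of k "Suc k" r y] by (intro history_of_cong) auto
  ultimately show ?case by (simp split: action.split)
qed simp

lemma length_explore_le: "length (explore r y k) \<le> k"
  by (induction k) (auto split: action.splits)

lemma explore_stopped:
  "k \<le> l \<Longrightarrow> r (history_of y (explore r y k)) = Stop i \<Longrightarrow> explore r y l = explore r y k"
  by (induction l rule: dec_induct) auto

lemma admissible_history:
  "admissible_rule r \<Longrightarrow> distinct os \<Longrightarrow>
     r (history_of y os) \<in> Open ` (- set os) \<union> Stop ` set os"
  unfolding admissible_rule_def by (metis fst_history_of)

lemma distinct_explore: "admissible_rule r \<Longrightarrow> distinct (explore r y k)"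
proof (induction k)
  case (Suc k)
  then show ?case using admissible_history[of r "explore r y k" y] by (auto split: action.splits)
qed simp

lemma distinct_opened: "admissible_rule r \<Longrightarrow> distinct (opened r y)"
  unfolding opened_def by (rule distinct_explore)

lemma explore_full_or_stopped:
  "length (explore r y k) = k \<or> (\<exists>i. r (history_of y (explore r y k)) = Stop i)"
proof (induction k)
  case (Suc k)
  then show ?case by (cases "r (history_of y (explore r y k))") auto
qed simp

lemma length_distinct_le_card: "distinct (xs :: 'n::finite list) \<Longrightarrow> length xs \<le> CARD('n)"
  by (metis card_mono distinct_card finite subset_UNIV)

lemma chosen_eqI: "r (history_of y (opened r y)) = Stop i \<Longrightarrow> chosen r y = i"
  by (simp add: chosen_def)

text \<open>After \<open>CARD('n)\<close> stages a run has either stopped or opened every box, and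
  in the latter case admissibility leaves only stopping. So the definite description in
  \<open>chosen\<close> is well defined.\<close>

lemma stop_at_opened:
  assumes "admissible_rule r"
  shows "r (history_of y (opened r y)) = Stop (chosen r y)" "chosen r y \<in> set (opened r y)"
proof -
  have "\<exists>i\<in>set (opened r y). r (history_of y (opened r y)) = Stop i"
  proof (cases "\<exists>i. r (history_of y (opened r y)) = Stop i")
    case False
    then have "length (opened r y) = CARD('a)"
      using explore_full_or_stopped[of r y "CARD('a)"] by (auto simp: opened_def)
    then have "set (opened r y) = UNIV"
      using distinct_opened[OF assms, of y] by (metis card_eq_UNIV_imp_eq_UNIV distinct_card finite)
    then show ?thesis
      using admissible_history[OF assms distinct_opened[OF assms, of y], of y] by auto
  qed (use admissible_history[OF assms distinct_opened[OF assms, of y], of y] in auto)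
  then show "r (history_of y (opened r y)) = Stop (chosen r y)" "chosen r y \<in> set (opened r y)"
    using chosen_eqI[of r y] by auto
qed

definition reach :: "'n rule \<Rightarrow> ('n \<Rightarrow> real) \<Rightarrow> 'n list \<Rightarrow> bool" where
  "reach r y os \<longleftrightarrow> explore r y (length os) = os"

lemma reach_Nil [simp]: "reach r y []"
  by (simp add: reach_def)

lemma reach_snoc: "reach r y (os @ [j]) \<longleftrightarrow> reach r y os \<and> r (history_of y os) = Open j"
proof -
  \<comment> \<open>Had the last stage stopped instead of opening \<open>j\<close>, a list of length
    \<open>Suc (length os)\<close> would have been produced in \<open>length os\<close>
    stages.\<close>
  have "reach r y os" if "explore r y (Suc (length os)) = os @ [j]"
    using that length_explore_le[of r y "length os"]
    by (auto simp: reach_def split: action.splits)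
  then show ?thesis by (auto simp: reach_def split: action.splits)
qed

lemma reach_distinct: "admissible_rule r \<Longrightarrow> reach r y os \<Longrightarrow> distinct os"
  by (metis reach_def distinct_explore)

lemma reach_stop:
  fixes r :: "'n::finite rule"
  assumes "admissible_rule r" "reach r y os" "r (history_of y os) = Stop i"
  shows "opened r y = os" "chosen r y = i"
proof -
  show "opened r y = os"
    using explore_stopped[of "length os" "CARD('n)" r y i] assms
      length_distinct_le_card[OF reach_distinct[OF assms(1,2)]] by (simp add: opened_def reach_def)
  then show "chosen r y = i" using assms by (simp add: chosen_eqI)
qed

lemma reach_subset_opened:
  fixes r :: "'n::finite rule"
  assumes "admissible_rule r" "reach r y os"
  shows "set os \<subseteq> set (opened r y)"
  using explore_mono[of "length os" "CARD('n)" r y] assms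
    length_distinct_le_card[OF reach_distinct[OF assms]] by (simp add: opened_def reach_def)

lemma reach_cong:
  "(\<And>i. i \<in> set os \<Longrightarrow> y' i = y i) \<Longrightarrow> reach r y' os \<longleftrightarrow> reach r y os"
  unfolding reach_def by (metis explore_cong)

text \<open>A value is seen only after its box is opened, hence cannot influence whether it is
  opened. As a simplification rule this supplies the invariance premise of
  \<open>independent_value\<close>.\<close>

lemma mem_opened_upd [simp]:
  fixes r :: "'n::finite rule"
  shows "i \<in> set (opened r (y(i := a))) \<longleftrightarrow> i \<in> set (opened r y)"
proof -
  have *: "i \<notin> set (opened r (y(i := a)))" if "i \<notin> set (opened r y)" for y a
  proof -
    have "opened r (y(i := a)) = opened r y"
      unfolding opened_def by (rule explore_cong) (use that in \<open>auto simp: opened_def\<close>)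
    then show ?thesis using that by simp
  qed
  show ?thesis using *[of y a] *[of "y(i := a)" "y i"] by auto
qed

subsection \<open>Independence of the unopened boxes\<close>

text \<open>The cutoffs are arbitrary solutions of the reservation equation instead of values of
  \<open>reservation_value\<close>, so existence suffices in what follows. The common interval
  \<open>{0..1}\<close> bounds all integrands.\<close>

locale search_problem =
  fixes F :: "'n::finite \<Rightarrow> real measure" and c \<zeta> :: "'n \<Rightarrow> real"
  assumes dist: "\<And>i. distribution_on (F i) 0 1"
    and reservation: "\<And>i. c i = (LINT x|F i. max (x - \<zeta> i) 0)"
    and zeta_bounds: "\<And>i. 0 \<le> \<zeta> i" "\<And>i. \<zeta> i \<le> 1"
begin

lemma real_distribution_F: "real_distribution (F i)"
  using dist by (simp add: distribution_on_def)

lemma sets_F [simp]: "sets (F i) = sets borel"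
  by (rule real_distribution.events_eq_borel[OF real_distribution_F])

lemma space_F [simp]: "space (F i) = UNIV"
  by (rule real_distribution.space_eq_univ[OF real_distribution_F])

lemma prob_space_F: "prob_space (F i)"
  using real_distribution_F by (simp add: real_distribution_def)

sublocale F: product_prob_space F UNIV
  using prob_space_F by (intro product_prob_spaceI)

lemma space_PiM_F [simp]: "space (PiM UNIV F) = UNIV"
  by (simp add: space_PiM)

text \<open>Independence of coordinate \<open>j\<close> expressed as invariance under a fresh draw.
  On rectangles the constraint on coordinate \<open>j\<close> passes to the fresh draw and leaves
  \<open>UNIV\<close> behind.\<close>

lemma resample_values:
  "distr (PiM UNIV F \<Otimes>\<^sub>M F j) (PiM UNIV F) (\<lambda>(y, a). y(j := a)) = PiM UNIV F"
proof (rule F.PiM_eqI)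
  fix A assume A: "\<And>i. i \<in> UNIV \<Longrightarrow> A i \<in> sets (F i)"
  have m: "(\<lambda>(y, a). y(j := a)) \<in> (PiM UNIV F \<Otimes>\<^sub>M F j) \<rightarrow>\<^sub>M PiM UNIV F"
    using measurable_add_dim[of j UNIV F] by (simp add: insert_absorb)
  have B: "Pi\<^sub>E UNIV A \<in> sets (PiM UNIV F)"
    using A by (intro sets_PiM_I_finite) auto
  have B': "Pi\<^sub>E UNIV (A(j := UNIV)) \<in> sets (PiM UNIV F)"
    using A by (intro sets_PiM_I_finite) auto
  have pre: "(\<lambda>(y, a). y(j := a)) -` Pi\<^sub>E UNIV A \<inter> space (PiM UNIV F \<Otimes>\<^sub>M F j)
      = Pi\<^sub>E UNIV (A(j := UNIV)) \<times> A j"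
    by (auto simp: space_pair_measure PiE_iff split: if_splits)
  have "emeasure (distr (PiM UNIV F \<Otimes>\<^sub>M F j) (PiM UNIV F) (\<lambda>(y, a). y(j := a))) (Pi\<^sub>E UNIV A)
     = emeasure (PiM UNIV F) (Pi\<^sub>E UNIV (A(j := UNIV))) * emeasure (F j) (A j)"
    using A unfolding emeasure_distr[OF m B] pre
    by (intro F.M.emeasure_pair_measure_Times B') auto
  also have "\<dots> = (\<Prod>i\<in>UNIV. emeasure (F i) ((A(j := UNIV)) i)) * emeasure (F j) (A j)"
    using A by (subst F.emeasure_PiM) auto
  also have "\<dots> = (\<Prod>i\<in>UNIV. emeasure (F i) (A i))"
    using F.M.emeasure_space_1
    by (simp add: prod.remove[of UNIV j] mult.commute cong: prod.cong_simp)
  finally show "emeasure (distr (PiM UNIV F \<Otimes>\<^sub>M F j) (PiM UNIV F) (\<lambda>(y, a). y(j := a))) (Pi\<^sub>E UNIV A)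
     = (\<Prod>i\<in>UNIV. emeasure (F i) (A i))" .
qed auto

end

locale search = search_problem F c \<zeta>
  for F :: "'n::finite \<Rightarrow> real measure" and c \<zeta> :: "'n \<Rightarrow> real" +
  fixes U :: "real measure" and s :: "real \<Rightarrow> 'n rule"
  assumes strategy: "is_strategy (U, s)"
begin

abbreviation \<Omega> where "\<Omega> \<equiv> outcome_space F (U, s)"

lemma admissible: "admissible_rule (s u)"
  using strategy by (simp add: is_strategy_def)

sublocale U: real_distribution U
  using strategy by (simp add: is_strategy_def)

lemma Omega_eq: "\<Omega> = U \<Otimes>\<^sub>M PiM UNIV F"
  by (simp add: outcome_space_def)

sublocale P: pair_prob_space U "PiM UNIV F" ..

sublocale Om: prob_space \<Omega>
  unfolding Omega_eq by (rule P.prob_space_axioms)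

lemma space_Omega [simp]: "space \<Omega> = UNIV"
  by (simp add: Omega_eq space_pair_measure)

lemma sets_Omega: "sets \<Omega> = sets (borel \<Otimes>\<^sub>M (\<Pi>\<^sub>M i\<in>UNIV. borel))"
  unfolding Omega_eq by (intro sets_pair_measure_cong sets_PiM_cong) auto

lemma value_measurable [measurable]: "(\<lambda>w. snd w i) \<in> borel_measurable \<Omega>"
proof -
  have "(\<lambda>w. snd w i) \<in> borel_measurable (borel \<Otimes>\<^sub>M (\<Pi>\<^sub>M i\<in>UNIV. borel))"
    by measurable
  then show ?thesis by (simp add: measurable_cong_sets[OF sets_Omega refl])
qed

lemma device_measurable [measurable]: "fst \<in> borel_measurable \<Omega>"
  by (simp add: measurable_cong_sets[OF sets_Omega refl])

lemma resample_measurable: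
  "(\<lambda>(w, a). (fst w, (snd w)(j := a))) \<in> (\<Omega> \<Otimes>\<^sub>M F j) \<rightarrow>\<^sub>M \<Omega>"
proof -
  have upd: "(\<lambda>(y, a). y(j := a)) \<in> (PiM UNIV F \<Otimes>\<^sub>M F j) \<rightarrow>\<^sub>M PiM UNIV F"
    using measurable_add_dim[of j UNIV F] by (simp add: insert_absorb)
  have "(\<lambda>p. (\<lambda>(y, a). y(j := a)) (snd (fst p), snd p)) \<in> (U \<Otimes>\<^sub>M PiM UNIV F) \<Otimes>\<^sub>M F j \<rightarrow>\<^sub>M PiM UNIV F"
    by (rule measurable_compose[OF _ upd]) simp
  then show ?thesis unfolding Omega_eq by (simp add: split_beta')
qed

lemma resample:
  "distr (\<Omega> \<Otimes>\<^sub>M F j) \<Omega> (\<lambda>(w, a). (fst w, (snd w)(j := a))) = \<Omega>"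
proof -
  interpret R: pair_prob_space "PiM UNIV F" "F j" ..
  interpret Q: pair_prob_space \<Omega> "F j" ..
  let ?T = "\<lambda>(w, a). (fst w, (snd w)(j := a))"
  let ?T' = "\<lambda>(y, a). y(j := a)"
  have upd[measurable]: "?T' \<in> (PiM UNIV F \<Otimes>\<^sub>M F j) \<rightarrow>\<^sub>M PiM UNIV F"
    using measurable_add_dim[of j UNIV F] by (simp add: insert_absorb)
  note m = resample_measurable[of j]
  have "U \<Otimes>\<^sub>M PiM UNIV F = distr (\<Omega> \<Otimes>\<^sub>M F j) \<Omega> ?T"
  proof (rule pair_measure_eqI)
    fix A B assume A: "A \<in> sets U" and B: "B \<in> sets (PiM UNIV F)"
    have AB: "A \<times> B \<in> sets \<Omega>" using A B by (simp add: Omega_eq)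
    have ind_m: "(\<lambda>p. indicator (A \<times> B) (?T p) :: ennreal) \<in> borel_measurable (\<Omega> \<Otimes>\<^sub>M F j)"
      by (rule measurable_compose[OF m]) (use AB in simp)
    let ?C = "?T' -` B \<inter> space (PiM UNIV F \<Otimes>\<^sub>M F j)"
    have C[measurable]: "?C \<in> sets (PiM UNIV F \<Otimes>\<^sub>M F j)" using B upd by (rule measurable_sets[rotated])
    have ind: "indicator C (y, a) = (indicator B (y(j := a)) :: ennreal)" if "C = ?C" for y a C
      using that by (auto simp: indicator_def space_pair_measure)
    have "emeasure (distr (\<Omega> \<Otimes>\<^sub>M F j) \<Omega> ?T) (A \<times> B)
        = emeasure (\<Omega> \<Otimes>\<^sub>M F j) (?T -` (A \<times> B) \<inter> space (\<Omega> \<Otimes>\<^sub>M F j))"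
      by (rule emeasure_distr[OF m AB])
    also have "\<dots> = (\<integral>\<^sup>+p. indicator (A \<times> B) (?T p) \<partial>(\<Omega> \<Otimes>\<^sub>M F j))"
      using measurable_sets[OF m AB]
      by (subst nn_integral_indicator[symmetric])
         (auto intro!: nn_integral_cong simp del: nn_integral_indicator simp: indicator_def space_pair_measure)
    also have "\<dots> = (\<integral>\<^sup>+w. \<integral>\<^sup>+a. indicator (A \<times> B) (?T (w, a)) \<partial>F j \<partial>\<Omega>)"
      by (rule F.M.nn_integral_fst[OF ind_m, symmetric])
    also have "\<dots> = (\<integral>\<^sup>+u. \<integral>\<^sup>+y. \<integral>\<^sup>+a. indicator (A \<times> B) (?T ((u, y), a)) \<partial>F j \<partial>PiM UNIV F \<partial>U)"
      unfolding Omega_eq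
    proof (subst F.P.nn_integral_fst[symmetric])
      show "(\<lambda>w. \<integral>\<^sup>+a. indicator (A \<times> B) (?T (w, a)) \<partial>F j) \<in> borel_measurable (U \<Otimes>\<^sub>M PiM UNIV F)"
        using F.M.borel_measurable_nn_integral_fst[OF ind_m[unfolded Omega_eq]] by simp
    qed simp
    also have "\<dots> = (\<integral>\<^sup>+u. indicator A u * (\<integral>\<^sup>+y. \<integral>\<^sup>+a. indicator ?C (y, a) \<partial>F j \<partial>PiM UNIV F) \<partial>U)"
    proof (rule nn_integral_cong)
      fix u
      show "(\<integral>\<^sup>+y. \<integral>\<^sup>+a. indicator (A \<times> B) (?T ((u, y), a)) \<partial>F j \<partial>PiM UNIV F)
         = indicator A u * (\<integral>\<^sup>+y. \<integral>\<^sup>+a. indicator ?C (y, a) \<partial>F j \<partial>PiM UNIV F)"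
        by (cases "u \<in> A") (simp_all add: ind indicator_times)
    qed
    also have "\<dots> = emeasure U A * emeasure (PiM UNIV F \<Otimes>\<^sub>M F j) ?C"
      using A by (simp add: nn_integral_multc F.M.nn_integral_fst nn_integral_indicator[OF C])
    also have "emeasure (PiM UNIV F \<Otimes>\<^sub>M F j) ?C = emeasure (PiM UNIV F) B"
      using emeasure_distr[OF upd B] resample_values[of j] by simp
    finally show "emeasure U A * emeasure (PiM UNIV F) B
        = emeasure (distr (\<Omega> \<Otimes>\<^sub>M F j) \<Omega> ?T) (A \<times> B)" by (rule sym)
  qed (simp_all add: Omega_eq U.sigma_finite_measure_axioms F.P.sigma_finite_measure_axioms)
  then show ?thesis by (simp add: Omega_eq)
qed

text \<open>After coordinate \<open>j\<close> is replaced by a fresh draw, \<open>B\<close> still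
  sees only the old point and \<open>f\<close> only the draw, so the integral over the product
  factorizes.\<close>

lemma independent_value:
  assumes B: "Measurable.pred \<Omega> B" and inv: "\<And>w a. B (fst w, (snd w)(j := a)) \<longleftrightarrow> B w"
    and f: "f \<in> borel_measurable borel" "\<And>x. 0 \<le> f x"
  shows "(LINT w|\<Omega>. of_bool (B w) * f (snd w j)) = Om.prob {w. B w} * (LINT x|F j. f x)"
proof -
  interpret Q: pair_prob_space \<Omega> "F j" ..
  let ?T = "\<lambda>(w, a). (fst w, (snd w)(j := a))"
  note m = resample_measurable[of j]
  have f'[measurable]: "f \<in> borel_measurable (F j)" "f \<in> borel_measurable borel"
    using f by (auto simp: measurable_cong_sets[OF sets_F refl])
  note B[measurable]
  have Bs: "{w. B w} \<in> sets \<Omega>" using B by (simp add: pred_def)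
  have "(\<integral>\<^sup>+w. ennreal (of_bool (B w) * f (snd w j)) \<partial>\<Omega>)
      = (\<integral>\<^sup>+w. ennreal (of_bool (B w) * f (snd w j)) \<partial>distr (\<Omega> \<Otimes>\<^sub>M F j) \<Omega> ?T)"
    by (simp add: resample)
  also have "\<dots> = (\<integral>\<^sup>+p. ennreal (of_bool (B (fst p)) * f (snd p)) \<partial>(\<Omega> \<Otimes>\<^sub>M F j))"
    by (subst nn_integral_distr[OF m]) (auto simp: inv split_beta')
  also have "\<dots> = (\<integral>\<^sup>+w. \<integral>\<^sup>+a. indicator {w. B w} w * ennreal (f a) \<partial>F j \<partial>\<Omega>)"
    by (subst F.M.nn_integral_fst[symmetric]) (auto simp: indicator_def intro!: nn_integral_cong)
  also have "\<dots> = emeasure \<Omega> {w. B w} * (\<integral>\<^sup>+a. ennreal (f a) \<partial>F j)"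
    using Bs by (simp add: nn_integral_cmult nn_integral_multc)
  finally have *: "(\<integral>\<^sup>+w. ennreal (of_bool (B w) * f (snd w j)) \<partial>\<Omega>)
      = emeasure \<Omega> {w. B w} * (\<integral>\<^sup>+a. ennreal (f a) \<partial>F j)" .
  have "(LINT w|\<Omega>. of_bool (B w) * f (snd w j))
      = enn2real (\<integral>\<^sup>+w. ennreal (of_bool (B w) * f (snd w j)) \<partial>\<Omega>)"
    using f by (intro integral_eq_nn_integral) auto
  also have "\<dots> = Om.prob {w. B w} * enn2real (\<integral>\<^sup>+a. ennreal (f a) \<partial>F j)"
    unfolding * by (simp add: enn2real_mult measure_def)
  also have "enn2real (\<integral>\<^sup>+a. ennreal (f a) \<partial>F j) = (LINT x|F j. f x)"
    using f by (intro integral_eq_nn_integral[symmetric]) auto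
  finally show ?thesis .
qed

lemma independent_event:
  assumes B: "Measurable.pred \<Omega> B" and inv: "\<And>w a. B (fst w, (snd w)(j := a)) \<longleftrightarrow> B w"
    and C: "C \<in> sets borel"
  shows "Om.prob {w. B w \<and> snd w j \<in> C} = Om.prob {w. B w} * measure (F j) C"
proof -
  note B[measurable] C[measurable]
  have "Om.prob {w. B w \<and> snd w j \<in> C} = (LINT w|\<Omega>. indicator {w. B w \<and> snd w j \<in> C} w)"
    by simp
  also have "\<dots> = (LINT w|\<Omega>. of_bool (B w) * indicator C (snd w j))"
    by (intro Bochner_Integration.integral_cong) (auto simp: indicator_def)
  also have "\<dots> = Om.prob {w. B w} * measure (F j) C"
    using C by (subst independent_value[OF B inv]) auto
  finally show ?thesis .
qed

lemma AE_value:
  assumes "AE x in F i. P x" and P: "Measurable.pred borel P"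
  shows "AE w in \<Omega>. P (snd w i)"
proof -
  have C: "{x. P x} \<in> sets borel" using P by (simp add: pred_def)
  \<comment> \<open>The trivial event is invariant, so independence yields the marginal law of box
    \<open>i\<close>.\<close>
  have "Om.prob {w. True \<and> snd w i \<in> {x. P x}} = Om.prob {w. True} * measure (F i) {x. P x}"
    by (rule independent_event) (use C in auto)
  also have "measure (F i) {x. P x} = 1"
    using assms(1) C F.M.prob_eq_1[of "{x. P x}"] by simp
  finally have "Om.prob {w. P (snd w i)} = 1"
    using Om.prob_space by simp
  moreover have "{w. P (snd w i)} \<in> sets \<Omega>"
    using measurable_compose[OF value_measurable P, of i] by (simp add: pred_def)
  ultimately show ?thesis
    using Om.prob_eq_1[of "{w. P (snd w i)}"] by simp
qed

lemma AE_values: "AE w in \<Omega>. \<forall>i. snd w i \<in> {0..1}"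
  unfolding AE_all_countable
proof
  fix i
  show "AE w in \<Omega>. snd w i \<in> {0..1}"
    by (rule AE_value[where P="\<lambda>x. x \<in> {0..1}"]) (use dist[of i] in \<open>simp_all add: distribution_on_def\<close>)
qed

end

subsection \<open>Payoffs as a slack below a common bound\<close>

lemma reach_explore: "reach r y (explore r y k)"
proof (induction k)
  case (Suc k)
  then show ?case by (cases "r (history_of y (explore r y k))") (auto simp: reach_snoc)
qed simp

text \<open>Trades the definite description in \<open>chosen\<close> for reachability, which is
  measurable by induction along the list.\<close>

lemma outcome_iff:
  assumes "admissible_rule (r :: 'n::finite rule)"
  shows "opened r y = os \<and> chosen r y = i \<longleftrightarrow> reach r y os \<and> r (history_of y os) = Stop i"
  using stop_at_opened[OF assms, of y] reach_stop[OF assms, of y os i] reach_explore[of r y "CARD('n)"]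
  by (auto simp: opened_def)

text \<open>Since \<open>c i\<close> is the expectation of \<open>max (y i - \<zeta> i) 0\<close> and opening box \<open>i\<close> is independent of
  \<open>y i\<close>, the expected payoff is the expectation of \<open>kappa_max - slack\<close>.\<close>

definition kappa_max :: "('n::finite \<Rightarrow> real) \<Rightarrow> ('n \<Rightarrow> real) \<Rightarrow> real" where
  "kappa_max \<zeta> y = Max (range (\<lambda>i. min (y i) (\<zeta> i)))"

text \<open>The two possible losses: choosing a box whose capped value is not maximal, and leaving
  unchosen an opened box whose excess over the cutoff was paid for by its cost.\<close>

definition slack :: "('n::finite \<Rightarrow> real) \<Rightarrow> 'n rule \<Rightarrow> ('n \<Rightarrow> real) \<Rightarrow> real" where
  "slack \<zeta> r y = kappa_max \<zeta> y - min (y (chosen r y)) (\<zeta> (chosen r y))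
     + (\<Sum>i\<in>set (opened r y) - {chosen r y}. max (y i - \<zeta> i) 0)"

lemma kappa_le_max: "min (y i) (\<zeta> i) \<le> kappa_max \<zeta> (y :: 'n::finite \<Rightarrow> real)"
  unfolding kappa_max_def by (rule Max_ge) auto

lemma kappa_max_attained: "\<exists>i. kappa_max \<zeta> (y :: 'n::finite \<Rightarrow> real) = min (y i) (\<zeta> i)"
proof -
  have "kappa_max \<zeta> y \<in> range (\<lambda>i. min (y i) (\<zeta> i))"
    unfolding kappa_max_def by (rule Max_in) auto
  then show ?thesis by (simp add: image_iff)
qed

lemma slack_nonneg: "0 \<le> slack \<zeta> r y"
  using kappa_le_max[of y "chosen r y" \<zeta>] unfolding slack_def
  by (intro add_nonneg_nonneg sum_nonneg) auto

text \<open>A value is its capped value plus its excess, and the excess of the chosen box cancels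
  its own term in the sum.\<close>

lemma slack_eq:
  assumes "admissible_rule (r :: 'n::finite rule)"
  shows "y (chosen r y) - (\<Sum>i\<in>set (opened r y). max (y i - \<zeta> i) 0) = kappa_max \<zeta> y - slack \<zeta> r y"
proof -
  have "(\<Sum>i\<in>set (opened r y). max (y i - \<zeta> i) 0) = max (y (chosen r y) - \<zeta> (chosen r y)) 0
      + (\<Sum>i\<in>set (opened r y) - {chosen r y}. max (y i - \<zeta> i) 0)"
    using stop_at_opened(2)[OF assms] by (intro sum.remove) auto
  then show ?thesis by (simp add: slack_def min_def max_def)
qed

lemma slack_zero_imp:
  assumes "slack \<zeta> (r :: 'n::finite rule) y = 0" "i \<in> set (opened r y)" "\<zeta> i < y i"
  shows "chosen r y = i"
proof (rule ccontr)
  assume "chosen r y \<noteq> i"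
  then have "max (y i - \<zeta> i) 0 \<le> (\<Sum>i\<in>set (opened r y) - {chosen r y}. max (y i - \<zeta> i) 0)"
    using assms by (intro member_le_sum) auto
  then show False
    using assms kappa_le_max[of y "chosen r y" \<zeta>] by (simp add: slack_def)
qed

lemma finite_distinct_lists: "finite {xs :: 'n::finite list. distinct xs}"
  by (rule finite_subset[OF _ finite_lists_length_le[of "UNIV :: 'n set" "CARD('n)"]])
     (auto simp: length_distinct_le_card)

lemma sum_set_eq: "(\<Sum>i\<in>set xs. f i) = (\<Sum>i\<in>UNIV. of_bool (i \<in> set xs) * (f i :: real))"
  for xs :: "'n::finite list"
  by (intro sum.mono_neutral_cong_left) auto

context search_problem
begin

abbreviation "kappa_mean \<equiv> LINT y|PiM UNIV F. kappa_max \<zeta> y"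

lemma kappa_max_measurable [measurable]: "kappa_max \<zeta> \<in> borel_measurable (PiM UNIV F)"
proof -
  have "(\<lambda>y. Max ((\<lambda>i. min (y i) (\<zeta> i)) ` UNIV)) \<in> borel_measurable (\<Pi>\<^sub>M i\<in>UNIV. borel)"
    by (intro borel_measurable_Max) auto
  then show ?thesis
    by (simp add: kappa_max_def[abs_def] measurable_cong_sets[OF sets_PiM_cong[OF refl sets_F] refl])
qed

end

context search
begin

abbreviation "action w os \<equiv> s (fst w) (history_of (snd w) os)"
abbreviation "op w \<equiv> opened (s (fst w)) (snd w)"
abbreviation "ch w \<equiv> chosen (s (fst w)) (snd w)"

lemma pred_action:
  assumes "distinct os"
  shows "Measurable.pred \<Omega> (\<lambda>w. action w os = a)"
proof -
  have "(\<lambda>w. action w os) \<in> \<Omega> \<rightarrow>\<^sub>M count_space UNIV"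
    using strategy assms by (simp add: is_strategy_def measurable_cong_sets[OF sets_Omega refl] split_beta')
  then show ?thesis by (rule measurable_compose) simp
qed

lemma pred_reach [measurable]: "Measurable.pred \<Omega> (\<lambda>w. reach (s (fst w)) (snd w) os)"
proof (induction os rule: rev_induct)
  case (snoc j os)
  show ?case
  proof (cases "distinct os")
    case True
    note pred_action[OF True, measurable] snoc[measurable]
    show ?thesis unfolding reach_snoc by measurable
  next
    case False
    then have "\<not> reach (s (fst w)) (snd w) (os @ [j])" for w
      using reach_distinct[OF admissible, of "fst w" "snd w" os] by (auto simp: reach_snoc)
    then show ?thesis by simp
  qed
qed simp

lemma pred_outcome: "Measurable.pred \<Omega> (\<lambda>w. op w = os \<and> ch w = i)"
proof (cases "distinct os")
  case True
  note pred_action[OF True, measurable]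
  show ?thesis unfolding outcome_iff[OF admissible] by measurable
next
  case False
  then have "op w \<noteq> os" for w using distinct_opened[OF admissible] by blast
  then show ?thesis by simp
qed

lemma pred_chosen [measurable]: "Measurable.pred \<Omega> (\<lambda>w. ch w = i)"
proof -
  have "(\<lambda>w. ch w = i) = (\<lambda>w. \<exists>os\<in>{xs. distinct xs}. op w = os \<and> ch w = i)"
    using distinct_opened[OF admissible] by auto
  also have "Measurable.pred \<Omega> \<dots>"
    by (intro pred_intros_finite finite_distinct_lists pred_outcome)
  finally show ?thesis .
qed

lemma pred_opened [measurable]: "Measurable.pred \<Omega> (\<lambda>w. i \<in> set (op w))"
proof -
  have "(\<lambda>w. i \<in> set (op w)) = (\<lambda>w. \<exists>os\<in>{xs. distinct xs \<and> i \<in> set xs}. \<exists>k\<in>UNIV. op w = os \<and> ch w = k)"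
    using distinct_opened[OF admissible] by auto
  also have "Measurable.pred \<Omega> \<dots>"
    by (intro pred_intros_finite pred_outcome finite_subset[OF _ finite_distinct_lists]) auto
  finally show ?thesis .
qed

lemma integrable_bounded:
  fixes f :: "real \<times> ('n \<Rightarrow> real) \<Rightarrow> real" and B :: real
  assumes "f \<in> borel_measurable \<Omega>" "\<And>w. (\<And>i. snd w i \<in> {0..1}) \<Longrightarrow> \<bar>f w\<bar> \<le> B"
  shows "integrable \<Omega> f"
proof (rule Om.integrable_const_bound[where B=B])
  show "AE w in \<Omega>. norm (f w) \<le> B" using AE_values by eventually_elim (use assms in auto)
qed (use assms in auto)

lemma chosen_value_eq: "snd w (ch w) = (\<Sum>i\<in>UNIV. of_bool (ch w = i) * snd w i)"
  by (simp add: of_bool_def if_distrib[of "\<lambda>x. x * _"] cong: if_cong)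

lemma chosen_value_measurable [measurable]: "(\<lambda>w. snd w (ch w)) \<in> borel_measurable \<Omega>"
  unfolding chosen_value_eq by measurable

lemma kappa_max_snd_measurable [measurable]: "(\<lambda>w. kappa_max \<zeta> (snd w)) \<in> borel_measurable \<Omega>"
  unfolding Omega_eq by (rule measurable_compose[OF measurable_snd kappa_max_measurable])

lemma integrable_kappa_max: "integrable \<Omega> (\<lambda>w. kappa_max \<zeta> (snd w))"
proof (rule integrable_bounded[where B=1])
  fix w :: "real \<times> ('n \<Rightarrow> real)" assume *: "\<And>i. snd w i \<in> {0..1}"
  obtain i where "kappa_max \<zeta> (snd w) = min (snd w i) (\<zeta> i)" using kappa_max_attained by blast
  then show "\<bar>kappa_max \<zeta> (snd w)\<bar> \<le> 1" using *[of i] zeta_bounds[of i] by auto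
qed simp

lemma integrable_opened_sum:
  fixes B :: "'n \<Rightarrow> real"
  assumes [measurable]: "\<And>i. f i \<in> borel_measurable \<Omega>"
    and "\<And>i w. (\<And>i. snd w i \<in> {0..1}) \<Longrightarrow> \<bar>f i w\<bar> \<le> B i"
  shows "integrable \<Omega> (\<lambda>w. of_bool (i \<in> set (op w)) * f i w)"
proof (rule integrable_bounded[where B="\<bar>B i\<bar>"])
  fix w :: "real \<times> ('n \<Rightarrow> real)" assume "\<And>i. snd w i \<in> {0..1}"
  then show "\<bar>of_bool (i \<in> set (op w)) * f i w\<bar> \<le> \<bar>B i\<bar>"
    using assms(2)[of w i] by (cases "i \<in> set (op w)") auto
qed simp

lemma integral_kappa_max: "(LINT w|\<Omega>. kappa_max \<zeta> (snd w)) = kappa_mean"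
proof -
  have "(LINT w|\<Omega>. kappa_max \<zeta> (snd w)) = (LINT u|U. LINT y|PiM UNIV F. kappa_max \<zeta> (snd (u, y)))"
    using P.integral_fst'[OF integrable_kappa_max[unfolded Omega_eq]] by (simp add: Omega_eq)
  then show ?thesis using U.prob_space by simp
qed

text \<open>The amortization behind the cutoffs: paying \<open>c i\<close> on opening is, in
  expectation, the same as giving up the excess over \<open>\<zeta> i\<close>, because the decision
  to open is independent of the value.\<close>

lemma expected_excess:
  "(LINT w|\<Omega>. of_bool (i \<in> set (op w)) * max (snd w i - \<zeta> i) 0) = Om.prob {w. i \<in> set (op w)} * c i"
  unfolding reservation by (rule independent_value) auto

lemma integrable_slack: "integrable \<Omega> (\<lambda>w. slack \<zeta> (s (fst w)) (snd w))"
  and payoff_eq: "payoff c F (U, s) = kappa_mean - (LINT w|\<Omega>. slack \<zeta> (s (fst w)) (snd w))"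
proof -
  have iy: "integrable \<Omega> (\<lambda>w. snd w (ch w))"
    by (rule integrable_bounded[where B=1]) auto
  have iex: "integrable \<Omega> (\<lambda>w. of_bool (i \<in> set (op w)) * max (snd w i - \<zeta> i) 0)" for i
  proof (rule integrable_opened_sum[where B="\<lambda>_. 1"])
    fix i and w :: "real \<times> ('n \<Rightarrow> real)" assume "\<And>i. snd w i \<in> {0..1}"
    then have "snd w i \<in> {0..1}" .
    then show "\<bar>max (snd w i - \<zeta> i) 0\<bar> \<le> 1" using zeta_bounds[of i] by auto
  qed measurable
  have ic: "integrable \<Omega> (\<lambda>w. of_bool (i \<in> set (op w)) * c i)" for i
    by (rule integrable_opened_sum[where B="\<lambda>i. \<bar>c i\<bar>"]) auto
  have eq: "slack \<zeta> (s (fst w)) (snd w) = kappa_max \<zeta> (snd w)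
      - (snd w (ch w) - (\<Sum>i\<in>UNIV. of_bool (i \<in> set (op w)) * max (snd w i - \<zeta> i) 0))" for w
    using slack_eq[OF admissible, of "snd w" "fst w" \<zeta>] unfolding sum_set_eq by linarith
  have ie: "integrable \<Omega> (\<lambda>w. snd w (ch w) - (\<Sum>i\<in>UNIV. of_bool (i \<in> set (op w)) * max (snd w i - \<zeta> i) 0))"
    by (intro Bochner_Integration.integrable_diff Bochner_Integration.integrable_sum iy iex)
  then show i: "integrable \<Omega> (\<lambda>w. slack \<zeta> (s (fst w)) (snd w))"
    unfolding eq by (intro Bochner_Integration.integrable_diff[OF integrable_kappa_max])
  have "payoff c F (U, s) = (LINT w|\<Omega>. snd w (ch w) - (\<Sum>i\<in>UNIV. of_bool (i \<in> set (op w)) * c i))"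
    unfolding payoff_def sum_set_eq split_beta' by (simp only: snd_conv)
  also have "\<dots> = (LINT w|\<Omega>. snd w (ch w)) - (\<Sum>i\<in>UNIV. Om.prob {w. i \<in> set (op w)} * c i)"
  proof -
    have "(LINT w|\<Omega>. of_bool (i \<in> set (op w)) * c i) = Om.prob {w. i \<in> set (op w)} * c i" for i
    proof -
      have "(LINT w|\<Omega>. of_bool (i \<in> set (op w))) = (LINT w|\<Omega>. indicator {w. i \<in> set (op w)} w :: real)"
        by (intro Bochner_Integration.integral_cong) (auto simp: indicator_def)
      then show ?thesis by simp
    qed
    note * = this
    show ?thesis
      by (subst Bochner_Integration.integral_diff[OF iy Bochner_Integration.integrable_sum[OF ic]],
          subst Bochner_Integration.integral_sum[OF ic]) (simp only: *)
  qed
  also have "\<dots> = (LINT w|\<Omega>. snd w (ch w) - (\<Sum>i\<in>UNIV. of_bool (i \<in> set (op w)) * max (snd w i - \<zeta> i) 0))"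
    by (subst Bochner_Integration.integral_diff[OF iy Bochner_Integration.integrable_sum[OF iex]],
        subst Bochner_Integration.integral_sum[OF iex]) (simp only: expected_excess)
  also have "\<dots> = kappa_mean - (LINT w|\<Omega>. slack \<zeta> (s (fst w)) (snd w))"
    unfolding eq integral_kappa_max[symmetric]
    using Bochner_Integration.integral_diff[OF integrable_kappa_max ie] by linarith
  finally show "payoff c F (U, s) = kappa_mean - (LINT w|\<Omega>. slack \<zeta> (s (fst w)) (snd w))" .
qed

lemma payoff_le: "payoff c F (U, s) \<le> kappa_mean"
  using payoff_eq integral_nonneg_AE[of "\<lambda>w. slack \<zeta> (s (fst w)) (snd w)" \<Omega>] slack_nonneg by auto

lemma payoff_eq_iff: "payoff c F (U, s) = kappa_mean \<longleftrightarrow> (AE w in \<Omega>. slack \<zeta> (s (fst w)) (snd w) = 0)"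
  using payoff_eq integral_nonneg_eq_0_iff_AE[OF integrable_slack] slack_nonneg by auto

end

subsection \<open>Pandora's rule\<close>

lemma real_distribution_return: "real_distribution (return borel a)"
  by (simp add: real_distribution_def real_distribution_axioms_def prob_space_return)

primrec best_box :: "'n history \<Rightarrow> 'n" where
  "best_box [] = undefined"
| "best_box (p # h) = (if \<forall>q\<in>set h. snd q \<le> snd p then fst p else best_box h)"

lemma best_box_max: "h \<noteq> [] \<Longrightarrow> \<exists>x. (best_box h, x) \<in> set h \<and> (\<forall>q\<in>set h. snd q \<le> x)"
proof (induction h)
  case (Cons p h)
  show ?case
  proof (cases "\<forall>q\<in>set h. snd q \<le> snd p")
    case True
    then show ?thesis by (intro exI[of _ "snd p"]) auto
  next
    case False
    then obtain q x where q: "q \<in> set h" "snd p < snd q" "(best_box h, x) \<in> set h" "\<forall>q\<in>set h. snd q \<le> x"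
      using Cons.IH by (metis empty_iff empty_set not_le)
    then have "snd p \<le> x" by force
    then show ?thesis using False q by auto
  qed
qed simp

definition next_box :: "('n \<Rightarrow> real) \<Rightarrow> 'n list \<Rightarrow> 'n" where
  "next_box \<zeta> os = (SOME j. j \<notin> set os \<and> (\<forall>k. k \<notin> set os \<longrightarrow> \<zeta> k \<le> \<zeta> j))"

lemma next_box:
  fixes os :: "'n::finite list"
  assumes "set os \<noteq> UNIV"
  shows "next_box \<zeta> os \<notin> set os" "k \<notin> set os \<Longrightarrow> \<zeta> k \<le> \<zeta> (next_box \<zeta> os)"
proof -
  have "\<zeta> ` (- set os) \<noteq> {}" using assms by auto
  then have "Max (\<zeta> ` (- set os)) \<in> \<zeta> ` (- set os)" by (intro Max_in) auto
  then obtain j where "j \<notin> set os" "\<zeta> j = Max (\<zeta> ` (- set os))" by auto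
  then have "\<exists>j. j \<notin> set os \<and> (\<forall>k. k \<notin> set os \<longrightarrow> \<zeta> k \<le> \<zeta> j)"
    by (intro exI[of _ j]) auto
  from someI_ex[OF this] show "next_box \<zeta> os \<notin> set os" "k \<notin> set os \<Longrightarrow> \<zeta> k \<le> \<zeta> (next_box \<zeta> os)"
    by (auto simp: next_box_def)
qed

definition pandora :: "('n \<Rightarrow> real) \<Rightarrow> 'n rule" where
  "pandora \<zeta> h =
     (if h \<noteq> [] \<and> (fst ` set h = UNIV \<or> (\<exists>q\<in>set h. \<zeta> (next_box \<zeta> (map fst h)) \<le> snd q))
      then Stop (best_box h) else Open (next_box \<zeta> (map fst h)))"

lemma pandora_admissible: "admissible_rule (pandora (\<zeta> :: 'n::finite \<Rightarrow> real))"
  unfolding admissible_rule_def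
proof (intro allI impI)
  fix h :: "'n history"
  have "Stop (best_box h) \<in> Stop ` fst ` set h" if "h \<noteq> []"
  proof -
    from best_box_max[OF that] obtain x where "(best_box h, x) \<in> set h" by blast
    then show ?thesis by (metis fst_conv image_eqI)
  qed
  moreover have "next_box \<zeta> (map fst h) \<notin> fst ` set h" if "fst ` set h \<noteq> UNIV"
    using next_box(1)[of "map fst h" \<zeta>] that by simp
  ultimately show "pandora \<zeta> h \<in> Open ` (- fst ` set h) \<union> Stop ` fst ` set h"
    by (cases "h = []") (simp_all add: pandora_def)
qed

lemma pred_value_le:
  "Measurable.pred (borel \<Otimes>\<^sub>M (\<Pi>\<^sub>M i\<in>UNIV. borel)) (\<lambda>w :: real \<times> ('n::finite \<Rightarrow> real). snd w j \<le> snd w i)"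
  "Measurable.pred (borel \<Otimes>\<^sub>M (\<Pi>\<^sub>M i\<in>UNIV. borel)) (\<lambda>w :: real \<times> ('n::finite \<Rightarrow> real). snd w i \<le> a)"
  "Measurable.pred (borel \<Otimes>\<^sub>M (\<Pi>\<^sub>M i\<in>UNIV. borel)) (\<lambda>w :: real \<times> ('n::finite \<Rightarrow> real). a \<le> snd w i)"
proof -
  have v [measurable]: "(\<lambda>w :: real \<times> ('n \<Rightarrow> real). snd w i) \<in> borel_measurable (borel \<Otimes>\<^sub>M (\<Pi>\<^sub>M i\<in>UNIV. borel))" for i
    by measurable
  show "Measurable.pred (borel \<Otimes>\<^sub>M (\<Pi>\<^sub>M i\<in>UNIV. borel)) (\<lambda>w :: real \<times> ('n \<Rightarrow> real). snd w j \<le> snd w i)"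
    "Measurable.pred (borel \<Otimes>\<^sub>M (\<Pi>\<^sub>M i\<in>UNIV. borel)) (\<lambda>w :: real \<times> ('n \<Rightarrow> real). snd w i \<le> a)"
    "Measurable.pred (borel \<Otimes>\<^sub>M (\<Pi>\<^sub>M i\<in>UNIV. borel)) (\<lambda>w :: real \<times> ('n \<Rightarrow> real). a \<le> snd w i)"
    using borel_measurable_le[OF v[of j] v[of i]] borel_measurable_le[OF v[of i] borel_measurable_const[of a]]
      borel_measurable_le[OF borel_measurable_const[of a] v[of i]] by (simp_all only: pred_def)
qed

lemma best_box_measurable:
  "(\<lambda>w :: real \<times> ('n::finite \<Rightarrow> real). best_box (history_of (snd w) os)) \<in> borel \<Otimes>\<^sub>M (\<Pi>\<^sub>M i\<in>UNIV. borel) \<rightarrow>\<^sub>M count_space UNIV"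
proof (induction os)
  case (Cons i os)
  have *: "Measurable.pred (borel \<Otimes>\<^sub>M (\<Pi>\<^sub>M i\<in>UNIV. borel))
      (\<lambda>w :: real \<times> ('n \<Rightarrow> real). \<forall>j\<in>set os. snd w j \<le> snd w i)"
    by (intro pred_intros_finite finite_set pred_value_le)
  have eq: "best_box (history_of y (i # os)) =
     (if \<forall>j\<in>set os. y j \<le> y i then i else best_box (history_of y os))" for y
    by (auto simp: history_of_def)
  show ?case unfolding eq using * Cons by (intro measurable_If) (auto simp: pred_def)
qed (simp add: history_of_def)

lemma pandora_strategy: "is_strategy (return borel 0, \<lambda>_. pandora (\<zeta> :: 'n::finite \<Rightarrow> real))"
proof -
  have "(\<lambda>w :: real \<times> ('n \<Rightarrow> real). pandora \<zeta> (history_of (snd w) os)) \<in> borel \<Otimes>\<^sub>M (\<Pi>\<^sub>M i\<in>UNIV. borel) \<rightarrow>\<^sub>M count_space UNIV" for os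
  proof -
    have *: "Measurable.pred (borel \<Otimes>\<^sub>M (\<Pi>\<^sub>M i\<in>UNIV. borel)) (\<lambda>w :: real \<times> ('n \<Rightarrow> real).
        os \<noteq> [] \<and> (set os = UNIV \<or> (\<exists>i\<in>set os. \<zeta> (next_box \<zeta> os) \<le> snd w i)))"
      by (intro pred_intros_logic pred_intros_finite finite_set pred_value_le) auto
    have eq: "pandora \<zeta> (history_of y os) =
      (if os \<noteq> [] \<and> (set os = UNIV \<or> (\<exists>i\<in>set os. \<zeta> (next_box \<zeta> os) \<le> y i))
       then Stop (best_box (history_of y os)) else Open (next_box \<zeta> os))" for y
      by (auto simp: pandora_def) (auto simp: history_of_def)
    show ?thesis unfolding eq using * measurable_compose[OF best_box_measurable, of Stop "count_space UNIV" os]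
      by (intro measurable_If) (auto simp: pred_def)
  qed
  then show ?thesis
    by (simp add: is_strategy_def split_beta' pandora_admissible real_distribution_return)
qed

text \<open>The second half records why the last box was opened: no earlier value had reached its
  cutoff, which is at most theirs.\<close>

lemma pandora_invariant:
  fixes \<zeta> :: "'n::finite \<Rightarrow> real"
  assumes "reach (pandora \<zeta>) y os"
  shows "(\<forall>i\<in>set os. \<forall>j. j \<notin> set os \<longrightarrow> \<zeta> j \<le> \<zeta> i) \<and>
    (\<forall>i\<in>set (butlast os). y i < \<zeta> (last os) \<and> \<zeta> (last os) \<le> \<zeta> i)"
  using assms
proof (induction os rule: rev_induct)
  case (snoc j os)
  have r: "reach (pandora \<zeta>) y os" and o: "pandora \<zeta> (history_of y os) = Open j"
    using snoc.prems by (auto simp: reach_snoc)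
  note IH = snoc.IH[OF r]
  have "j = next_box \<zeta> os" and n: "os = [] \<or> set os \<noteq> UNIV \<and> (\<forall>i\<in>set os. y i < \<zeta> j)"
    using o by (auto simp: pandora_def history_of_def image_image o_def not_le split: if_splits)
  then have ne: "set os \<noteq> UNIV" by auto
  note j = next_box[OF ne, where \<zeta>=\<zeta>, folded \<open>j = next_box \<zeta> os\<close>]
  show ?case using IH n j by auto
qed simp

lemma pandora_slack: "slack \<zeta> (pandora \<zeta>) y = 0" for \<zeta> :: "'n::finite \<Rightarrow> real"
proof -
  let ?r = "pandora \<zeta>" let ?os = "opened ?r y" let ?k = "chosen ?r y"
  note adm = pandora_admissible[of \<zeta>]
  have r: "reach ?r y ?os" and st: "?r (history_of y ?os) = Stop ?k"
    using outcome_iff[OF adm, of y ?os ?k] by auto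
  note inv = pandora_invariant[OF r]
  have ne: "?os \<noteq> []" and k: "?k = best_box (history_of y ?os)"
    and stop: "set ?os = UNIV \<or> (\<exists>i\<in>set ?os. \<zeta> (next_box \<zeta> ?os) \<le> y i)"
    using st by (auto simp: pandora_def history_of_def image_image o_def split: if_splits)
  have kmax: "?k \<in> set ?os" "\<And>i. i \<in> set ?os \<Longrightarrow> y i \<le> y ?k"
    using best_box_max[of "history_of y ?os"] ne unfolding k[symmetric] by (auto simp: history_of_def)
  let ?l = "last ?os"
  have split: "i \<in> set (butlast ?os) \<or> i = ?l" if "i \<in> set ?os" for i
    using that ne by (metis append_butlast_last_id insert_iff list.set(1) list.set(2) set_append Un_iff empty_iff)
  have l: "?l \<in> set ?os" using ne by simp
  have unopened: "\<zeta> j \<le> y ?k" if "j \<notin> set ?os" for j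
  proof -
    have "\<exists>i\<in>set ?os. \<zeta> (next_box \<zeta> ?os) \<le> y i" "set ?os \<noteq> UNIV" using stop that by auto
    then show ?thesis using next_box(2)[of ?os j \<zeta>] kmax(2) that by fastforce
  qed
  \<comment> \<open>Only the last box can exceed its cutoff. If another box is chosen, its value is
    below that cutoff, and the last value is no larger.\<close>
  have low: "y i \<le> \<zeta> i" if "i \<in> set ?os" "i \<noteq> ?k" for i
  proof (cases "i \<in> set (butlast ?os)")
    case True
    then show ?thesis using inv by force
  next
    case False
    then have "i = ?l" using split that by auto
    moreover have "?k \<in> set (butlast ?os)" using split[OF kmax(1)] that \<open>i = ?l\<close> by auto
    ultimately show ?thesis using inv kmax(2)[OF that(1)] by force
  qed
  \<comment> \<open>An opened box is limited by the chosen value and, through the invariant, by the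
    cutoff of the chosen box; for an unopened one its cutoff is below both.\<close>
  have "min (y i) (\<zeta> i) \<le> min (y ?k) (\<zeta> ?k)" for i
  proof (cases "i \<in> set ?os")
    case True
    have "min (y i) (\<zeta> i) \<le> \<zeta> ?k"
    proof (cases "i = ?k")
      case False
      then show ?thesis using inv split[OF kmax(1)] split[OF True] low[OF True False] kmax(2)[OF True]
        by (smt (verit))
    qed simp
    then show ?thesis using kmax(2)[OF True] by auto
  next
    case False
    then show ?thesis using unopened[OF False] inv kmax(1) by force
  qed
  then have "kappa_max \<zeta> y = min (y ?k) (\<zeta> ?k)"
    using kappa_le_max[of y ?k \<zeta>] kappa_max_attained[of \<zeta> y] by (metis order_antisym)
  moreover have "(\<Sum>i\<in>set ?os - {?k}. max (y i - \<zeta> i) 0) = 0"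
    using low by (intro sum.neutral) auto
  ultimately show ?thesis by (simp add: slack_def)
qed

context search_problem
begin

lemma pandora_payoff: "payoff c F (return borel 0, \<lambda>_. pandora \<zeta>) = kappa_mean"
proof -
  interpret search F c \<zeta> "return borel 0" "\<lambda>_. pandora \<zeta>"
    by unfold_locales (rule pandora_strategy)
  show ?thesis by (simp add: payoff_eq_iff pandora_slack)
qed

lemma payoff_le_kappa_mean:
  assumes "is_strategy \<tau>"
  shows "payoff c F \<tau> \<le> kappa_mean"
proof -
  obtain U s where [simp]: "\<tau> = (U, s)" by (cases \<tau>)
  interpret search F c \<zeta> U s by unfold_locales (use assms in simp)
  show ?thesis using payoff_le by simp
qed

lemma optimal_payoff_eq: "optimal_payoff c F = kappa_mean"
  unfolding optimal_payoff_def
proof (rule cSup_eq_maximum)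
  show "kappa_mean \<in> payoff c F ` {\<sigma>. is_strategy \<sigma>}"
    using pandora_payoff pandora_strategy[of \<zeta>] by (intro image_eqI) auto
qed (use payoff_le_kappa_mean in auto)

lemma optimal_strategy_iff: "optimal_strategy c F \<sigma> \<longleftrightarrow> is_strategy \<sigma> \<and> payoff c F \<sigma> = kappa_mean"
  unfolding optimal_strategy_def
  using payoff_le_kappa_mean pandora_payoff pandora_strategy[of \<zeta>] by (metis order_antisym)

text \<open>The left-hand side is the expectation of \<open>min (y i) (\<zeta> i)\<close>.\<close>

lemma mean_minus_cost_le: "mean (F i) - c i \<le> kappa_mean"
proof -
  have proj: "distr (PiM UNIV F) (F i) (\<lambda>y. y i) = F i"
    by (rule F.PiM_component) simp
  interpret Fi: real_distribution "F i" by (rule real_distribution_F)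
  note int = distribution_on_integrable[OF dist[of i]]
  have im: "integrable (F i) (\<lambda>x. min x (\<zeta> i))" using int by (intro integrable_min) auto
  have m: "(\<lambda>y. y i) \<in> PiM UNIV F \<rightarrow>\<^sub>M F i" by (rule measurable_component_singleton) simp
  have mb: "(\<lambda>x. min x (\<zeta> i)) \<in> borel_measurable (F i)" using im by (rule borel_measurable_integrable)
  have "mean (F i) - c i = (LINT x|F i. x - max (x - \<zeta> i) 0)"
    using int by (simp add: mean_def reservation)
  also have "\<dots> = (LINT x|F i. min x (\<zeta> i))"
    by (intro Bochner_Integration.integral_cong) auto
  also have "\<dots> = (LINT y|PiM UNIV F. min (y i) (\<zeta> i))"
    by (subst proj[symmetric], rule integral_distr[OF m mb])
  also have "\<dots> \<le> kappa_mean"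
  proof (rule integral_mono)
    show "integrable (PiM UNIV F) (\<lambda>y. min (y i) (\<zeta> i))"
      using im proj integrable_distr_eq[OF m mb] by simp
    \<comment> \<open>An instance of the joint space from which integrability of
      \<open>kappa_max\<close> passes to the values alone.\<close>
    interpret search F c \<zeta> "return borel 0" "\<lambda>_. pandora \<zeta>"
      by unfold_locales (rule pandora_strategy)
    show "integrable (PiM UNIV F) (kappa_max \<zeta>)"
      using P.AE_integrable_fst'[OF integrable_kappa_max[unfolded Omega_eq]] by simp
  qed (rule kappa_le_max)
  finally show ?thesis .
qed

end

subsection \<open>Behaviors and plans\<close>

definition outcome_vec :: "'n::finite set \<Rightarrow> 'n \<Rightarrow> (real ^ 'n) \<times> (real ^ 'n)" where
  "outcome_vec A k = (\<chi> i. of_bool (i \<in> A), \<chi> i. of_bool (k = i))"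

text \<open>The expected outcome of the plan that has already opened \<open>pre\<close> without success, goes on opening
  the boxes of the last argument in turn until a success (which has probability \<open>p j\<close> at box \<open>j\<close>)
  and, after failures throughout, chooses \<open>k\<close>.\<close>

primrec plan_vec :: "('n::finite \<Rightarrow> real) \<Rightarrow> 'n \<Rightarrow> 'n list \<Rightarrow> 'n list \<Rightarrow> (real ^ 'n) \<times> (real ^ 'n)" where
  "plan_vec p k pre [] = outcome_vec (set pre) k"
| "plan_vec p k pre (j # os) =
     p j *\<^sub>R outcome_vec (set (pre @ [j])) j + (1 - p j) *\<^sub>R plan_vec p k (pre @ [j]) os"

text \<open>Since \<open>k\<close> must be among the opened boxes, \<open>plans []\<close> contains
  no empty list: at least one box is opened.\<close>

definition plans :: "'n list \<Rightarrow> ('n list \<times> 'n) set" where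
  "plans pre = {(os, k). distinct (pre @ os) \<and> k \<in> set (pre @ os)}"

lemma finite_plans: "finite (plans (pre :: 'n::finite list))"
  by (rule finite_subset[of _ "{xs. distinct xs} \<times> UNIV"])
     (auto simp: plans_def finite_distinct_lists)

text \<open>\<open>V pre\<close> is the best value among the finitely many continuations of
  \<open>pre\<close>. The Bellman inequality holds because prefixing \<open>j\<close> to a best
  continuation of \<open>pre @ [j]\<close> gives a continuation of \<open>pre\<close>.\<close>

lemma plan_value:
  fixes p :: "'n::finite \<Rightarrow> real" and \<gamma> :: "(real ^ 'n) \<times> (real ^ 'n)"
  assumes p: "\<And>i. 0 < p i" "\<And>i. p i \<le> 1"
  obtains V where
    "\<And>pre k. distinct pre \<Longrightarrow> k \<in> set pre \<Longrightarrow> \<gamma> \<bullet> outcome_vec (set pre) k \<le> V pre"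
    "\<And>pre j. distinct pre \<Longrightarrow> j \<notin> set pre \<Longrightarrow>
       p j * (\<gamma> \<bullet> outcome_vec (set (pre @ [j])) j) + (1 - p j) * V (pre @ [j]) \<le> V pre"
    "\<exists>(os, k)\<in>plans []. V [] = \<gamma> \<bullet> plan_vec p k [] os"
proof
  let ?g = "\<lambda>pre (os, k). \<gamma> \<bullet> plan_vec p k pre os"
  define V where "V pre = Max (?g pre ` plans pre)" for pre
  have ge: "\<gamma> \<bullet> plan_vec p k pre os \<le> V pre" if "(os, k) \<in> plans pre" for pre os k
    unfolding V_def using that finite_plans by (intro Max_ge) force+
  have att: "\<exists>(os, k)\<in>plans pre. V pre = \<gamma> \<bullet> plan_vec p k pre os" if "plans pre \<noteq> {}" for pre
  proof -
    have "V pre \<in> ?g pre ` plans pre"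
      unfolding V_def using that finite_plans by (intro Max_in) auto
    then show ?thesis by auto
  qed
  show "\<gamma> \<bullet> outcome_vec (set pre) k \<le> V pre" if "distinct pre" "k \<in> set pre" for pre k
    using ge[of "[]" k pre] that by (simp add: plans_def)
  show "p j * (\<gamma> \<bullet> outcome_vec (set (pre @ [j])) j) + (1 - p j) * V (pre @ [j]) \<le> V pre"
    if "distinct pre" "j \<notin> set pre" for pre j
  proof -
    have "([], j) \<in> plans (pre @ [j])" using that by (simp add: plans_def)
    then obtain os k where ok: "(os, k) \<in> plans (pre @ [j])" "V (pre @ [j]) = \<gamma> \<bullet> plan_vec p k (pre @ [j]) os"
      using att[of "pre @ [j]"] by blast
    then have "(j # os, k) \<in> plans pre" by (auto simp: plans_def)
    from ge[OF this] ok(2) show ?thesis by (simp add: inner_add_right)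
  qed
  have "([undefined], undefined) \<in> plans []" by (simp add: plans_def)
  then show "\<exists>(os, k)\<in>plans []. V [] = \<gamma> \<bullet> plan_vec p k [] os" using att by blast
qed

context search
begin

abbreviation "hit j \<equiv> measure (F j) {\<zeta> j<..}"

text \<open>The states of the dynamic program: once a success occurs, \<open>decisive\<close>
  settles the outcome.\<close>

definition "alive w os \<longleftrightarrow> reach (s (fst w)) (snd w) os \<and> (\<forall>i\<in>set os. snd w i \<le> \<zeta> i)"

definition "reward \<gamma> w = \<gamma> \<bullet> outcome_vec (set (op w)) (ch w)"

text \<open>The only consequence of optimality that the dynamic program uses. For optimal strategies
  it follows from zero slack, for plan rules it holds at every outcome.\<close>

definition "decisive \<longleftrightarrow> (AE w in \<Omega>. \<forall>os j. alive w os \<longrightarrow> action w os = Open j \<longrightarrow> \<zeta> j < snd w j \<longrightarrow>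
    op w = os @ [j] \<and> ch w = j)"

lemma pred_alive [measurable]: "Measurable.pred \<Omega> (\<lambda>w. alive w os)"
proof -
  have "Measurable.pred \<Omega> (\<lambda>w. snd w i \<le> \<zeta> i)" for i by measurable
  then show ?thesis unfolding alive_def
    by (intro pred_intros_logic pred_reach pred_intros_finite finite_set)
qed

lemma reward_eq:
  "reward \<gamma> w = (\<Sum>i\<in>UNIV. fst \<gamma> $ i * of_bool (i \<in> set (op w))) + (\<Sum>i\<in>UNIV. snd \<gamma> $ i * of_bool (ch w = i))"
  by (simp only: reward_def outcome_vec_def inner_prod_def inner_vec_def fst_conv snd_conv vec_lambda_beta inner_real_def)

lemma reward_measurable [measurable]: "reward \<gamma> \<in> borel_measurable \<Omega>"
  unfolding reward_eq[abs_def] by measurable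

lemma reward_bound: "\<bar>reward \<gamma> w\<bar> \<le> (\<Sum>i\<in>UNIV. \<bar>fst \<gamma> $ i\<bar>) + (\<Sum>i\<in>UNIV. \<bar>snd \<gamma> $ i\<bar>)"
  unfolding reward_eq
  by (intro order_trans[OF abs_triangle_ineq] add_mono order_trans[OF sum_abs] sum_mono) auto

lemma integrable_event:
  assumes [measurable]: "Measurable.pred \<Omega> B"
  shows "integrable \<Omega> (\<lambda>w. of_bool (B w) * reward \<gamma> w)"
proof (rule integrable_bounded)
  show "\<bar>of_bool (B w) * reward \<gamma> w\<bar> \<le> (\<Sum>i\<in>UNIV. \<bar>fst \<gamma> $ i\<bar>) + (\<Sum>i\<in>UNIV. \<bar>snd \<gamma> $ i\<bar>)" for w
    using reward_bound[of \<gamma> w] by (cases "B w") (auto intro: sum_nonneg add_nonneg_nonneg)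
qed measurable

lemma integral_of_bool: "(LINT w|\<Omega>. of_bool (B w)) = Om.prob {w. B w}"
proof -
  have "(LINT w|\<Omega>. of_bool (B w)) = (LINT w|\<Omega>. indicator {w. B w} w :: real)"
    by (intro Bochner_Integration.integral_cong) (auto simp: indicator_def)
  then show ?thesis by simp
qed

lemma integral_const_on_event:
  assumes [measurable]: "Measurable.pred \<Omega> B" and "AE w in \<Omega>. B w \<longrightarrow> reward \<gamma> w = a"
  shows "(LINT w|\<Omega>. of_bool (B w) * reward \<gamma> w) = Om.prob {w. B w} * a"
proof -
  have "(LINT w|\<Omega>. of_bool (B w) * reward \<gamma> w) = (LINT w|\<Omega>. of_bool (B w) * a)"
  proof (rule integral_cong_AE)
    show "AE w in \<Omega>. of_bool (B w) * reward \<gamma> w = of_bool (B w) * a"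
      using assms(2) by eventually_elim auto
  qed measurable
  then show ?thesis by (simp add: integral_of_bool)
qed

lemma behavior_inner: "\<gamma> \<bullet> (search_behavior F (U, s), choice_behavior F (U, s)) = (LINT w|\<Omega>. reward \<gamma> w)"
proof -
  have i: "integrable \<Omega> (\<lambda>w. a * of_bool (B w))" if [measurable]: "Measurable.pred \<Omega> B" for B and a :: real
    by (rule integrable_bounded[where B="\<bar>a\<bar>"]) auto
  have sum_i: "integrable \<Omega> (\<lambda>w. \<Sum>i\<in>UNIV. fst \<gamma> $ i * of_bool (i \<in> set (op w)))"
    "integrable \<Omega> (\<lambda>w. \<Sum>i\<in>UNIV. snd \<gamma> $ i * of_bool (ch w = i))"
    by (intro Bochner_Integration.integrable_sum i pred_opened pred_chosen)+
  have "(LINT w|\<Omega>. reward \<gamma> w) = (\<Sum>i\<in>UNIV. fst \<gamma> $ i * Om.prob {w. i \<in> set (op w)})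
      + (\<Sum>i\<in>UNIV. snd \<gamma> $ i * Om.prob {w. ch w = i})"
    unfolding reward_eq
    by (simp only: Bochner_Integration.integral_add[OF sum_i(1) sum_i(2)]
        Bochner_Integration.integral_sum[OF i[OF pred_opened]] Bochner_Integration.integral_sum[OF i[OF pred_chosen]]
        integral_mult_right_zero integral_of_bool)
  then show ?thesis
    by (simp add: search_behavior_def choice_behavior_def inner_prod_def inner_vec_def)
qed

text \<open>Opening another box after a success would produce, with positive probability, two opened boxes
  above their cutoffs, one of which is not chosen.\<close>

lemma decisiveI:
  assumes opt: "AE w in \<Omega>. slack \<zeta> (s (fst w)) (snd w) = 0" and hit: "\<And>i. 0 < hit i"
  shows decisive
proof -
  have ch: "AE w in \<Omega>. \<forall>i. i \<in> set (op w) \<longrightarrow> \<zeta> i < snd w i \<longrightarrow> ch w = i"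
    using opt by eventually_elim (meson slack_zero_imp)
  have "AE w in \<Omega>. \<not> (reach (s (fst w)) (snd w) (os @ [l]) \<and> (\<exists>j\<in>set os. \<zeta> j < snd w j))" for os l
  proof (cases "distinct (os @ [l])")
    case True
    let ?E = "\<lambda>w. reach (s (fst w)) (snd w) (os @ [l]) \<and> (\<exists>j\<in>set os. \<zeta> j < snd w j)"
    have "Measurable.pred \<Omega> (\<lambda>w. \<zeta> j < snd w j)" for j by measurable
    then have E: "Measurable.pred \<Omega> ?E"
      by (intro pred_intros_logic pred_reach pred_intros_finite finite_set)
    \<comment> \<open>Whether \<open>l\<close> is opened next depends on the boxes in
      \<open>os\<close> alone, and \<open>l\<close> is not among them.\<close>
    have inv: "?E (fst w, (snd w)(l := a)) \<longleftrightarrow> ?E w" for w a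
    proof -
      have "reach (s (fst w)) ((snd w)(l := a)) os = reach (s (fst w)) (snd w) os"
        using True by (intro reach_cong) auto
      moreover have "history_of ((snd w)(l := a)) os = history_of (snd w) os"
        using True by (intro history_of_cong) auto
      ultimately show ?thesis using True by (auto simp: reach_snoc)
    qed
    have "AE w in \<Omega>. \<not> (?E w \<and> snd w l \<in> {\<zeta> l<..})"
      using ch
    proof eventually_elim
      case (elim w)
      show ?case
      proof
        assume *: "?E w \<and> snd w l \<in> {\<zeta> l<..}"
        then obtain j where j: "j \<in> set os" "\<zeta> j < snd w j" by auto
        moreover have "set (os @ [l]) \<subseteq> set (op w)" using * reach_subset_opened[OF admissible] by blast
        ultimately have "ch w = j" "ch w = l" using elim * by auto
        then show False using True j by auto
      qed
    qed
    then have "Om.prob {w. ?E w \<and> snd w l \<in> {\<zeta> l<..}} = 0"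
    proof (subst Om.prob_eq_0)
      have "Measurable.pred \<Omega> (\<lambda>w. snd w l \<in> {\<zeta> l<..})" by measurable
      with E have "Measurable.pred \<Omega> (\<lambda>w. ?E w \<and> snd w l \<in> {\<zeta> l<..})"
        by (rule pred_intros_logic)
      then show "{w. ?E w \<and> snd w l \<in> {\<zeta> l<..}} \<in> Om.events" by (simp only: pred_def space_Omega UNIV_I simp_thms)
    qed simp
    \<comment> \<open>The null probability factorizes as that of \<open>?E\<close> times
      \<open>hit l\<close>, and \<open>hit l\<close> is positive.\<close>
    then have "Om.prob {w. ?E w} = 0"
      using independent_event[OF E inv, of "{\<zeta> l<..}"] hit[of l] by simp
    moreover have "{w. ?E w} \<in> Om.events" using E by (simp only: pred_def space_Omega UNIV_I simp_thms)
    ultimately have "AE w in \<Omega>. w \<notin> {w. ?E w}" by (simp only: Om.prob_eq_0)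
    then show ?thesis by (simp only: mem_Collect_eq)
  next
    case False
    then show ?thesis using reach_distinct[OF admissible] by (intro AE_I2) blast
  qed
  then have "AE w in \<Omega>. \<forall>os l. \<not> (reach (s (fst w)) (snd w) (os @ [l]) \<and> (\<exists>j\<in>set os. \<zeta> j < snd w j))"
    unfolding AE_all_countable by blast
  with ch show ?thesis unfolding decisive_def
  proof eventually_elim
    case (elim w)
    show ?case
    proof (intro allI impI)
      fix os j assume *: "alive w os" "action w os = Open j" "\<zeta> j < snd w j"
      then have r: "reach (s (fst w)) (snd w) (os @ [j])" by (simp add: reach_snoc alive_def)
      have "action w (os @ [j]) \<noteq> Open l" for l
      proof
        assume "action w (os @ [j]) = Open l"
        then have "reach (s (fst w)) (snd w) ((os @ [j]) @ [l])"
          unfolding reach_snoc[of _ _ "os @ [j]"] using r by (rule conjI[rotated])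
        then show False using spec[OF spec[OF elim(2), of "os @ [j]"], of l] * by auto
      qed
      then obtain k where "action w (os @ [j]) = Stop k" by (cases "action w (os @ [j])") auto
      from reach_stop[OF admissible r this] have "op w = os @ [j]" by simp
      then show "op w = os @ [j] \<and> ch w = j" using elim(1) * by auto
    qed
  qed
qed

text \<open>\<open>H\<close> is decided before the value of \<open>j\<close> is seen, so success at
  \<open>j\<close> is independent of it. Success fixes the reward by \<open>decisive\<close>,
  failure leads to the state \<open>os @ [j]\<close>. The condition \<open>Q\<close> on the device
  later isolates a single plan.\<close>

lemma open_step:
  assumes dec: decisive and os: "distinct os" "j \<notin> set os"
    and Q: "Measurable.pred borel Q"
  defines "H \<equiv> \<lambda>w. Q (fst w) \<and> alive w os \<and> action w os = Open j"
  shows "Measurable.pred \<Omega> H"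
    and "Om.prob {w. Q (fst w) \<and> alive w (os @ [j])} = Om.prob {w. H w} * (1 - hit j)"
    and "(LINT w|\<Omega>. of_bool (H w) * reward \<gamma> w) =
      Om.prob {w. H w} * (hit j * (\<gamma> \<bullet> outcome_vec (set (os @ [j])) j))
      + (LINT w|\<Omega>. of_bool (Q (fst w) \<and> alive w (os @ [j])) * reward \<gamma> w)"
proof -
  have Q': "Measurable.pred \<Omega> (\<lambda>w. Q (fst w))" by (rule measurable_compose[OF device_measurable Q])
  show H: "Measurable.pred \<Omega> H"
    unfolding H_def using os by (intro pred_intros_logic Q' pred_alive pred_action)
  note [measurable] = H Q'
  have inv: "H (fst w, (snd w)(j := a)) \<longleftrightarrow> H w" for w a
  proof -
    have "reach (s (fst w)) ((snd w)(j := a)) os = reach (s (fst w)) (snd w) os"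
      using os by (intro reach_cong) auto
    moreover have "history_of ((snd w)(j := a)) os = history_of (snd w) os"
      using os by (intro history_of_cong) auto
    ultimately show ?thesis using os by (auto simp: H_def alive_def)
  qed
  have next_alive: "Q (fst w) \<and> alive w (os @ [j]) \<longleftrightarrow> H w \<and> \<not> \<zeta> j < snd w j" for w
    by (auto simp: H_def alive_def reach_snoc not_less)
  have hit: "Om.prob {w. H w \<and> \<zeta> j < snd w j} = Om.prob {w. H w} * hit j"
    using independent_event[OF H inv, of "{\<zeta> j<..}"] by simp
  have v: "Measurable.pred \<Omega> (\<lambda>w. \<zeta> j < snd w j)" by measurable
  have Hs: "{w. H w} \<in> sets \<Omega>" "{w. \<zeta> j < snd w j} \<in> sets \<Omega>" using H v by (simp_all add: pred_def)
  let ?S = "{w. H w \<and> \<zeta> j < snd w j}" and ?T = "{w. H w \<and> \<not> \<zeta> j < snd w j}"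
  have ev: "?S \<in> Om.events" "?T \<in> Om.events"
    using sets.Int[OF Hs] sets.Diff[OF Hs] by (simp_all add: Int_def set_diff_eq)
  have un: "{w. H w} = ?S \<union> ?T" and disj: "?S \<inter> ?T = {}" by blast+
  have "Om.prob {w. H w} = Om.prob ?S + Om.prob ?T"
    by (rule trans[OF arg_cong[OF un, where f=Om.prob] Om.finite_measure_Union[OF ev disj]])
  then show "Om.prob {w. Q (fst w) \<and> alive w (os @ [j])} = Om.prob {w. H w} * (1 - hit j)"
    unfolding next_alive hit right_diff_distrib mult_1_right by linarith
  have "(LINT w|\<Omega>. of_bool (H w) * reward \<gamma> w) =
     (LINT w|\<Omega>. of_bool (H w \<and> \<zeta> j < snd w j) * reward \<gamma> w + of_bool (H w \<and> \<not> \<zeta> j < snd w j) * reward \<gamma> w)"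
    by (intro Bochner_Integration.integral_cong) auto
  also have "\<dots> = (LINT w|\<Omega>. of_bool (H w \<and> \<zeta> j < snd w j) * reward \<gamma> w)
     + (LINT w|\<Omega>. of_bool (H w \<and> \<not> \<zeta> j < snd w j) * reward \<gamma> w)"
    by (intro Bochner_Integration.integral_add integrable_event pred_intros_logic H v)
  also have "(LINT w|\<Omega>. of_bool (H w \<and> \<zeta> j < snd w j) * reward \<gamma> w)
     = Om.prob {w. H w \<and> \<zeta> j < snd w j} * (\<gamma> \<bullet> outcome_vec (set (os @ [j])) j)"
  proof (rule integral_const_on_event)
    show "AE w in \<Omega>. H w \<and> \<zeta> j < snd w j \<longrightarrow> reward \<gamma> w = \<gamma> \<bullet> outcome_vec (set (os @ [j])) j"
      using dec unfolding decisive_def by eventually_elim (auto simp: reward_def H_def)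
  qed (intro pred_intros_logic H v)
  finally show "(LINT w|\<Omega>. of_bool (H w) * reward \<gamma> w) =
      Om.prob {w. H w} * (hit j * (\<gamma> \<bullet> outcome_vec (set (os @ [j])) j))
      + (LINT w|\<Omega>. of_bool (Q (fst w) \<and> alive w (os @ [j])) * reward \<gamma> w)"
    unfolding next_alive hit by (simp add: mult.assoc)
qed

lemma stop_step:
  fixes k :: 'n
  assumes os: "distinct os" and Q: "Measurable.pred borel Q"
  defines "H \<equiv> \<lambda>w. Q (fst w) \<and> alive w os \<and> action w os = Stop k"
  shows "(LINT w|\<Omega>. of_bool (H w) * reward \<gamma> w) = Om.prob {w. H w} * (\<gamma> \<bullet> outcome_vec (set os) k)"
proof (rule integral_const_on_event)
  have Q': "Measurable.pred \<Omega> (\<lambda>w. Q (fst w))" by (rule measurable_compose[OF device_measurable Q])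
  show "Measurable.pred \<Omega> H"
    unfolding H_def using os by (intro pred_intros_logic Q' pred_alive pred_action)
  show "AE w in \<Omega>. H w \<longrightarrow> reward \<gamma> w = \<gamma> \<bullet> outcome_vec (set os) k"
  proof (rule AE_I2, rule impI)
    fix w assume "H w"
    then show "reward \<gamma> w = \<gamma> \<bullet> outcome_vec (set os) k"
      using reach_stop[OF admissible, of "fst w" "snd w" os k] by (simp add: H_def alive_def reward_def)
  qed
qed

text \<open>Backward induction on the number of unopened boxes. Integrals restricted to events
  replace conditional expectations: the state is split by the next action, which may depend on the
  device and on all observed values.\<close>

lemma reward_le_value:
  assumes dec: decisive and p: "\<And>i. p i \<le> hit i"
    and V_stop: "\<And>pre k. distinct pre \<Longrightarrow> k \<in> set pre \<Longrightarrow> \<gamma> \<bullet> outcome_vec (set pre) k \<le> V pre"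
    and V_open: "\<And>pre j. distinct pre \<Longrightarrow> j \<notin> set pre \<Longrightarrow>
       p j * (\<gamma> \<bullet> outcome_vec (set (pre @ [j])) j) + (1 - p j) * V (pre @ [j]) \<le> V pre"
    and "distinct os"
  shows "(LINT w|\<Omega>. of_bool (alive w os) * reward \<gamma> w) \<le> Om.prob {w. alive w os} * V os"
  using \<open>distinct os\<close>
proof (induction "CARD('n) - length os" arbitrary: os rule: less_induct)
  case less
  let ?H = "\<lambda>a w. alive w os \<and> action w os = a"
  let ?A = "range Open \<union> range Stop :: 'n action set"
  have H: "Measurable.pred \<Omega> (?H a)" for a
    using less.prems by (intro pred_intros_logic pred_alive pred_action)
  have A: "action w os \<in> ?A" for w by (cases "action w os") auto
  have split: "of_bool (alive w os) = (\<Sum>a\<in>?A. of_bool (?H a w) :: real)" for w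
  proof -
    have "(\<Sum>a\<in>?A. of_bool (?H a w) :: real) = (\<Sum>a\<in>{action w os}. of_bool (?H a w))"
      using A by (intro sum.mono_neutral_right) auto
    then show ?thesis by simp
  qed
  have bound: "(LINT w|\<Omega>. of_bool (?H a w) * reward \<gamma> w) \<le> Om.prob {w. ?H a w} * V os" for a
  proof (cases a)
    case (Stop k)
    show ?thesis
    proof (cases "k \<in> set os")
      case True
      have "(LINT w|\<Omega>. of_bool (?H a w) * reward \<gamma> w) = Om.prob {w. ?H a w} * (\<gamma> \<bullet> outcome_vec (set os) k)"
        using stop_step[OF less.prems, where Q="\<lambda>_. True" and \<gamma>=\<gamma> and k=k] Stop by simp
      also have "\<dots> \<le> Om.prob {w. ?H a w} * V os"
        using V_stop[OF less.prems True] by (intro mult_left_mono) auto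
      finally show ?thesis .
    next
      case False
      then have "\<not> ?H a w" for w
        using admissible_history[OF admissible less.prems, of "fst w" "snd w"] Stop by auto
      then show ?thesis by (simp only: of_bool_eq) simp
    qed
  next
    case (Open j)
    show ?thesis
    proof (cases "j \<in> set os")
      case False
      let ?g = "\<gamma> \<bullet> outcome_vec (set (os @ [j])) j"
      have d: "distinct (os @ [j])" using less.prems False by simp
      have "CARD('n) - length (os @ [j]) < CARD('n) - length os"
        using length_distinct_le_card[OF d] by simp
      from less.hyps[OF this d]
      have IH: "(LINT w|\<Omega>. of_bool (alive w (os @ [j])) * reward \<gamma> w)
          \<le> Om.prob {w. alive w (os @ [j])} * V (os @ [j])" .
      have "(LINT w|\<Omega>. of_bool (?H a w) * reward \<gamma> w) = Om.prob {w. ?H a w} * (hit j * ?g)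
          + (LINT w|\<Omega>. of_bool (alive w (os @ [j])) * reward \<gamma> w)"
        using open_step(3)[OF dec less.prems False, of "\<lambda>_. True" \<gamma>] Open by simp
      also have "\<dots> \<le> Om.prob {w. ?H a w} * (hit j * ?g) + Om.prob {w. alive w (os @ [j])} * V (os @ [j])"
        using IH by simp
      also have "Om.prob {w. alive w (os @ [j])} = Om.prob {w. ?H a w} * (1 - hit j)"
        using open_step(2)[OF dec less.prems False, of "\<lambda>_. True"] Open by simp
      also have "Om.prob {w. ?H a w} * (hit j * ?g) + Om.prob {w. ?H a w} * (1 - hit j) * V (os @ [j])
          = Om.prob {w. ?H a w} * (hit j * ?g + (1 - hit j) * V (os @ [j]))"
        by (simp add: algebra_simps)
      also have "\<dots> \<le> Om.prob {w. ?H a w} * V os"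
      proof (rule mult_left_mono)
        \<comment> \<open>Stopping at once with \<open>j\<close> is a continuation of
          \<open>os @ [j]\<close>. Hence failure is worth at least as much as success, and lowering
          \<open>hit j\<close> to \<open>p j\<close> does not decrease the value.\<close>
        have "?g \<le> V (os @ [j])" using V_stop[OF d, of j] by simp
        then have "0 \<le> (hit j - p j) * (V (os @ [j]) - ?g)" using p[of j] by simp
        then have "hit j * ?g + (1 - hit j) * V (os @ [j]) \<le> p j * ?g + (1 - p j) * V (os @ [j])"
          by (simp add: algebra_simps)
        also have "\<dots> \<le> V os" by (rule V_open[OF less.prems False])
        finally show "hit j * ?g + (1 - hit j) * V (os @ [j]) \<le> V os" .
      qed simp
      finally show ?thesis .
    next
      case True
      then have "\<not> ?H a w" for w
        using admissible_history[OF admissible less.prems, of "fst w" "snd w"] Open by auto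
      then show ?thesis by (simp only: of_bool_eq) simp
    qed
  qed
  have "(LINT w|\<Omega>. of_bool (alive w os) * reward \<gamma> w) = (LINT w|\<Omega>. (\<Sum>a\<in>?A. of_bool (?H a w) * reward \<gamma> w))"
    unfolding split sum_distrib_right ..
  also have "\<dots> = (\<Sum>a\<in>?A. LINT w|\<Omega>. of_bool (?H a w) * reward \<gamma> w)"
    by (intro Bochner_Integration.integral_sum integrable_event H)
  also have "\<dots> \<le> (\<Sum>a\<in>?A. Om.prob {w. ?H a w} * V os)"
    by (intro sum_mono bound)
  also have "\<dots> = (\<Sum>a\<in>?A. LINT w|\<Omega>. of_bool (?H a w)) * V os"
    unfolding integral_of_bool sum_distrib_right ..
  also have "(\<Sum>a\<in>?A. LINT w|\<Omega>. of_bool (?H a w)) = (LINT w|\<Omega>. (\<Sum>a\<in>?A. of_bool (?H a w) :: real))"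
  proof (rule Bochner_Integration.integral_sum[symmetric])
    show "integrable \<Omega> (\<lambda>w. of_bool (?H a w) :: real)" for a
      using H[of a] by (intro integrable_bounded[where B=1]) auto
  qed
  also have "\<dots> = Om.prob {w. alive w os}" unfolding split[symmetric] integral_of_bool ..
  finally show ?case .
qed

lemma behavior_le_plan:
  assumes dec: decisive and p: "\<And>i. 0 < p i" "\<And>i. p i \<le> 1" "\<And>i. p i \<le> hit i"
  shows "\<exists>(os, k)\<in>plans []. \<gamma> \<bullet> (search_behavior F (U, s), choice_behavior F (U, s)) \<le> \<gamma> \<bullet> plan_vec p k [] os"
proof -
  obtain V where V: "\<And>pre k. distinct pre \<Longrightarrow> k \<in> set pre \<Longrightarrow> \<gamma> \<bullet> outcome_vec (set pre) k \<le> V pre"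
    "\<And>pre j. distinct pre \<Longrightarrow> j \<notin> set pre \<Longrightarrow>
       p j * (\<gamma> \<bullet> outcome_vec (set (pre @ [j])) j) + (1 - p j) * V (pre @ [j]) \<le> V pre"
    "\<exists>(os, k)\<in>plans []. V [] = \<gamma> \<bullet> plan_vec p k [] os"
    by (rule plan_value[of p \<gamma>, OF p(1,2)], rule that) assumption+
  have "alive w []" for w by (simp add: alive_def)
  then have "(LINT w|\<Omega>. reward \<gamma> w) \<le> V []"
    using reward_le_value[OF dec p(3) V(1,2), of "[]"] Om.prob_space by simp
  then have "\<gamma> \<bullet> (search_behavior F (U, s), choice_behavior F (U, s)) \<le> V []"
    unfolding behavior_inner .
  moreover obtain os k where "(os, k) \<in> plans []" "V [] = \<gamma> \<bullet> plan_vec p k [] os"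
    using V(3) by (elim bexE) (simp split: prod.splits)
  ultimately show ?thesis by (intro bexI[of _ "(os, k)"]) auto
qed

text \<open>\<open>Q\<close> is the event that the randomization device prescribes the plan \<open>(pre @ os, k)\<close>.\<close>

lemma plan_reward:
  assumes dec: decisive and Q: "Measurable.pred borel Q"
    and plan_open: "\<And>u y as j bs. Q u \<Longrightarrow> pre @ os = as @ j # bs \<Longrightarrow> (\<And>i. i \<in> set as \<Longrightarrow> y i \<le> \<zeta> i) \<Longrightarrow>
       s u (history_of y as) = Open j"
    and plan_stop: "\<And>u y. Q u \<Longrightarrow> (\<And>i. i \<in> set (pre @ os) \<Longrightarrow> y i \<le> \<zeta> i) \<Longrightarrow>
       s u (history_of y (pre @ os)) = Stop k"
    and "distinct (pre @ os)"
  shows "(LINT w|\<Omega>. of_bool (Q (fst w) \<and> alive w pre) * reward \<gamma> w) =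
    Om.prob {w. Q (fst w) \<and> alive w pre} * (\<gamma> \<bullet> plan_vec hit k pre os)"
  using plan_open plan_stop \<open>distinct (pre @ os)\<close>
proof (induction os arbitrary: pre)
  case Nil
  have "(Q (fst w) \<and> alive w pre) = (Q (fst w) \<and> alive w pre \<and> action w pre = Stop k)" for w
    using Nil.prems(2)[of "fst w" "snd w"] by (auto simp: alive_def)
  then show ?case using stop_step[OF _ Q, where os=pre and \<gamma>=\<gamma> and k=k] Nil.prems(3) by simp
next
  case (Cons j os)
  have H: "(Q (fst w) \<and> alive w pre) = (Q (fst w) \<and> alive w pre \<and> action w pre = Open j)" for w
    using Cons.prems(1)[of "fst w" pre j os "snd w"] by (auto simp: alive_def)
  have d: "distinct pre" "j \<notin> set pre" using Cons.prems(3) by auto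
  have "(LINT w|\<Omega>. of_bool (Q (fst w) \<and> alive w (pre @ [j])) * reward \<gamma> w) =
    Om.prob {w. Q (fst w) \<and> alive w (pre @ [j])} * (\<gamma> \<bullet> plan_vec hit k (pre @ [j]) os)"
  proof (rule Cons.IH)
    show "s u (history_of y as) = Open i"
      if "Q u" "(pre @ [j]) @ os = as @ i # bs" "\<And>i. i \<in> set as \<Longrightarrow> y i \<le> \<zeta> i" for u y as i bs
      by (rule Cons.prems(1)[OF that(1) _ that(3)]) (use that(2) in auto)
    show "s u (history_of y ((pre @ [j]) @ os)) = Stop k"
      if "Q u" "\<And>i. i \<in> set ((pre @ [j]) @ os) \<Longrightarrow> y i \<le> \<zeta> i" for u y
      using Cons.prems(2)[of u y] that by simp
  qed (use Cons.prems(3) in auto)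
  note IH = this
  show ?case
    unfolding H open_step(3)[OF dec d Q] IH open_step(2)[OF dec d Q]
    by (simp add: inner_add_right algebra_simps)
qed

end

subsection \<open>Mixtures of plans\<close>

text \<open>The last branch serves two purposes: it chooses the box that has just succeeded, and it
  keeps the rule admissible on histories that deviate from the plan.\<close>

definition plan_rule :: "('n \<Rightarrow> real) \<Rightarrow> 'n list \<times> 'n \<Rightarrow> 'n rule" where
  "plan_rule \<zeta> a h =
     (if h = [] then Open (hd (fst a))
      else if (\<forall>q\<in>set h. snd q \<le> \<zeta> (fst q)) \<and> take (length h) (fst a) = map fst h
      then if length h < length (fst a) then Open (fst a ! length h) else Stop (snd a)
      else Stop (fst (last h)))"

lemma plan_rule_admissible:
  assumes "a \<in> plans []"
  shows "admissible_rule (plan_rule \<zeta> a)"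
  unfolding admissible_rule_def
proof (intro allI impI)
  fix h :: "'a history"
  obtain os k where a: "a = (os, k)" "distinct os" "k \<in> set os" using assms by (auto simp: plans_def)
  show "plan_rule \<zeta> a h \<in> Open ` (- fst ` set h) \<union> Stop ` fst ` set h"
  proof (cases "h = [] \<or> take (length h) os \<noteq> map fst h")
    case True
    then show ?thesis by (cases "h = []") (auto simp: plan_rule_def a)
  next
    case False
    then have h: "h \<noteq> []" "fst ` set h = set (take (length h) os)"
      by simp_all
    have "os ! length h \<notin> fst ` set h" if "length h < length os"
    proof -
      have "distinct (take (Suc (length h)) os)" using a(2) by simp
      then show ?thesis unfolding h(2) using that by (simp add: take_Suc_conv_app_nth)
    qed
    moreover have "k \<in> fst ` set h" if "\<not> length h < length os"
      unfolding h(2) using that a(3) by simp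
    ultimately show ?thesis using h(1) by (simp add: plan_rule_def a)
  qed
qed

lemma plan_rule_history:
  "plan_rule \<zeta> a (history_of y os) =
     (if os = [] then Open (hd (fst a))
      else if (\<forall>i\<in>set os. y i \<le> \<zeta> i) \<and> take (length os) (fst a) = os
      then if length os < length (fst a) then Open (fst a ! length os) else Stop (snd a)
      else Stop (last os))"
proof -
  have "length (history_of y os) = length os" "history_of y os = [] \<longleftrightarrow> os = []"
    "(\<forall>q\<in>set (history_of y os). snd q \<le> \<zeta> (fst q)) \<longleftrightarrow> (\<forall>i\<in>set os. y i \<le> \<zeta> i)"
    "os \<noteq> [] \<Longrightarrow> fst (last (history_of y os)) = last os"
    by (auto simp: history_of_def last_map)
  then show ?thesis by (simp add: plan_rule_def)
qed

lemma plan_rule_open: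
  assumes "\<And>i. i \<in> set as \<Longrightarrow> y i \<le> \<zeta> i"
  shows "plan_rule \<zeta> (as @ j # bs, k) (history_of y as) = Open j"
  using assms by (simp add: plan_rule_history)

lemma plan_rule_stop:
  assumes "\<And>i. i \<in> set os \<Longrightarrow> y i \<le> \<zeta> i" "os \<noteq> []"
  shows "plan_rule \<zeta> (os, k) (history_of y os) = Stop k"
  using assms by (simp add: plan_rule_history)

lemma plan_rule_success: "\<zeta> j < y j \<Longrightarrow> plan_rule \<zeta> a (history_of y (os @ [j])) = Stop j"
  by (auto simp: plan_rule_history)

text \<open>A box is opened only while no earlier one has succeeded, so at most the last box exceeds
  its cutoff, and then it is chosen.\<close>

lemma plan_rule_unchosen:
  fixes a :: "'n::finite list \<times> 'n"
  assumes a: "a \<in> plans []" and i: "i \<in> set (opened (plan_rule \<zeta> a) y)" "i \<noteq> chosen (plan_rule \<zeta> a) y"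
  shows "y i \<le> \<zeta> i"
proof -
  let ?r = "plan_rule \<zeta> a" let ?os = "opened ?r y"
  note adm = plan_rule_admissible[OF a, of \<zeta>]
  have r: "reach ?r y ?os" and st: "?r (history_of y ?os) = Stop (chosen ?r y)"
    using outcome_iff[OF adm, of y ?os "chosen ?r y"] by auto
  have ne: "?os \<noteq> []" using i by auto
  show ?thesis
  proof (cases "\<forall>i\<in>set ?os. y i \<le> \<zeta> i")
    case False
    then have "?r (history_of y ?os) = Stop (last ?os)"
      using ne unfolding plan_rule_history by (simp only: if_False simp_thms)
    then have "chosen ?r y = last ?os" using st by simp
    then have i': "i \<in> set (butlast ?os)" using i ne by (metis append_butlast_last_id list.set(1,2) set_append Un_iff insert_iff empty_iff)
    have "?r (history_of y (butlast ?os)) = Open (last ?os)"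
      using r ne reach_snoc[of ?r y "butlast ?os" "last ?os"] by simp
    then show ?thesis using i' by (auto simp: plan_rule_history split: if_splits)
  qed (use i in auto)
qed

lemma plan_rule_measurable:
  "(\<lambda>w :: real \<times> ('n::finite \<Rightarrow> real). plan_rule \<zeta> a (history_of (snd w) os))
     \<in> borel \<Otimes>\<^sub>M (\<Pi>\<^sub>M i\<in>UNIV. borel) \<rightarrow>\<^sub>M count_space UNIV"
proof -
  have *: "Measurable.pred (borel \<Otimes>\<^sub>M (\<Pi>\<^sub>M i\<in>UNIV. borel))
      (\<lambda>w :: real \<times> ('n \<Rightarrow> real). \<forall>i\<in>set os. snd w i \<le> \<zeta> i)"
    by (intro pred_intros_finite finite_set pred_value_le)
  show ?thesis unfolding plan_rule_history
    by (intro measurable_If) (use * in \<open>auto simp: pred_def\<close>)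
qed

text \<open>The device draws the code of a plan; reals that encode no plan are sent to a fixed one.\<close>

definition decode :: "real \<Rightarrow> 'n::finite list \<times> 'n" where
  "decode u = (let a = from_nat (nat \<lfloor>u\<rfloor>) in if a \<in> plans [] then a else ([undefined], undefined))"

lemma decode_plans: "decode u \<in> plans []"
  by (auto simp: decode_def Let_def) (simp add: plans_def)

lemma decode_to_nat: "a \<in> plans [] \<Longrightarrow> decode (real (to_nat a)) = a"
  by (simp add: decode_def)

lemma decode_measurable: "decode \<in> borel \<rightarrow>\<^sub>M count_space UNIV"
proof -
  have "(\<lambda>u. (\<lambda>m. let a = from_nat (nat m) in if a \<in> plans [] then a else ([undefined], undefined)) \<lfloor>u :: real\<rfloor>)
      \<in> borel \<rightarrow>\<^sub>M count_space UNIV"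
    by (rule measurable_compose[OF measurable_real_floor]) simp
  then show ?thesis by (simp add: decode_def[abs_def])
qed

definition plan_mixture :: "('n \<Rightarrow> real) \<Rightarrow> ('n::finite list \<times> 'n) pmf \<Rightarrow> 'n strategy" where
  "plan_mixture \<zeta> q = (distr (measure_pmf q) borel (\<lambda>a. real (to_nat a)), \<lambda>u. plan_rule \<zeta> (decode u))"

lemma plan_mixture_strategy: "is_strategy (plan_mixture (\<zeta> :: 'n::finite \<Rightarrow> real) q)"
proof -
  have "real_distribution (distr (measure_pmf q) borel (\<lambda>a. real (to_nat a)))"
    by (rule prob_space.real_distribution_distr[OF measure_pmf.prob_space_axioms]) simp
  moreover have "(\<lambda>w. plan_rule \<zeta> (decode (fst w)) (history_of (snd w) os))
     \<in> borel \<Otimes>\<^sub>M (\<Pi>\<^sub>M i\<in>UNIV. borel) \<rightarrow>\<^sub>M count_space UNIV" for os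
    by (rule measurable_compose_countable[where f="\<lambda>a w. plan_rule \<zeta> a (history_of (snd w) os)"])
       (rule plan_rule_measurable, rule measurable_compose[OF measurable_fst decode_measurable])
  ultimately show ?thesis
    by (simp add: plan_mixture_def is_strategy_def split_beta' plan_rule_admissible[OF decode_plans])
qed

context search_problem
begin

text \<open>Both sides are tested against every \<open>\<gamma>\<close>: the expected reward splits
  over the plan drawn, and \<open>plan_reward\<close> evaluates each piece from the empty history,
  which is always alive.\<close>

lemma plan_mixture_behavior:
  fixes q :: "('n list \<times> 'n) pmf"
  assumes q: "set_pmf q \<subseteq> plans []"
  defines "\<sigma> \<equiv> plan_mixture \<zeta> q"
  shows "(search_behavior F \<sigma>, choice_behavior F \<sigma>) =
    (\<Sum>a\<in>plans []. pmf q a *\<^sub>R plan_vec (\<lambda>i. measure (F i) {\<zeta> i<..}) (snd a) [] (fst a))"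
proof -
  define U where "U = fst \<sigma>" define s where "s = snd \<sigma>"
  have \<sigma>: "\<sigma> = (U, s)" by (simp add: U_def s_def)
  have s: "s u = plan_rule \<zeta> (decode u)" for u by (simp add: s_def \<sigma>_def plan_mixture_def)
  interpret search F c \<zeta> U s
    by unfold_locales (use plan_mixture_strategy[of \<zeta> q] \<sigma> \<sigma>_def in simp)
  have dec: decisive
    unfolding decisive_def
  proof (intro AE_I2 allI impI)
    fix w os j assume *: "alive w os" "action w os = Open j" "\<zeta> j < snd w j"
    then have "reach (s (fst w)) (snd w) (os @ [j])" by (simp add: reach_snoc alive_def)
    from reach_stop[OF admissible this] show "op w = os @ [j] \<and> ch w = j"
      using plan_rule_success[of \<zeta> j "snd w" "decode (fst w)" os] * by (simp add: s)
  qed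
  have Q: "Measurable.pred borel (\<lambda>u. decode u = a)" for a :: "'n list \<times> 'n"
    by (rule measurable_compose[OF decode_measurable]) simp
  have Q': "Measurable.pred \<Omega> (\<lambda>w. decode (fst w) = a)" for a :: "'n list \<times> 'n"
    by (rule measurable_compose[OF device_measurable Q])
  have prob: "Om.prob {w. decode (fst w) = a} = pmf q a" if "a \<in> plans []" for a :: "'n list \<times> 'n"
  proof -
    have "{u. decode u = a} \<in> sets U" using Q[of a] by (simp add: pred_def)
    moreover have "{w. decode (fst w) = a} = {u. decode u = a} \<times> space (PiM UNIV F)" by auto
    ultimately have "Om.prob {w. decode (fst w) = a} = measure U {u. decode u = a}"
      using F.P.emeasure_pair_measure_Times[of "{u. decode u = a}" U "space (PiM UNIV F)"] F.P.emeasure_space_1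
        sets.top[of "PiM UNIV F"]
      by (simp add: measure_def Omega_eq)
    also have "\<dots> = measure (measure_pmf q) {b. decode (real (to_nat b)) = a}"
      using Q[of a] by (simp add: U_def \<sigma>_def plan_mixture_def measure_distr pred_def vimage_def)
    \<comment> \<open>\<open>q\<close> lives on plans, and there \<open>decode\<close> inverts
      \<open>to_nat\<close>.\<close>
    also have "\<dots> = measure (measure_pmf q) {a}"
      using q by (intro measure_pmf.finite_measure_eq_AE)
        (auto simp: AE_measure_pmf_iff decode_to_nat subset_eq)
    finally show ?thesis by (simp add: pmf.rep_eq)
  qed
  let ?P = "plans [] :: ('n list \<times> 'n) set"
  have "\<gamma> \<bullet> (search_behavior F \<sigma>, choice_behavior F \<sigma>) =
     \<gamma> \<bullet> (\<Sum>a\<in>?P. pmf q a *\<^sub>R plan_vec hit (snd a) [] (fst a))" for \<gamma>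
  proof -
    have split: "reward \<gamma> w = (\<Sum>a\<in>?P. of_bool (decode (fst w) = a) * reward \<gamma> w)" for w
    proof -
      have "(\<Sum>a\<in>?P. of_bool (decode (fst w) = a) * reward \<gamma> w)
          = (\<Sum>a\<in>{decode (fst w) :: 'n list \<times> 'n}. of_bool (decode (fst w) = a) * reward \<gamma> w)"
        by (intro sum.mono_neutral_right) (auto simp: decode_plans finite_plans)
      then show ?thesis by simp
    qed
    have plan: "(LINT w|\<Omega>. of_bool (decode (fst w) = a) * reward \<gamma> w)
        = pmf q a * (\<gamma> \<bullet> plan_vec hit (snd a) [] (fst a))" if a: "a \<in> ?P" for a
    proof -
      have ok: "distinct (fst a)" "fst a \<noteq> []" using a by (auto simp: plans_def)
      have al: "alive w []" for w by (simp add: alive_def)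
      have "(LINT w|\<Omega>. of_bool (decode (fst w) = a \<and> alive w []) * reward \<gamma> w) =
        Om.prob {w. decode (fst w) = a \<and> alive w []} * (\<gamma> \<bullet> plan_vec hit (snd a) [] (fst a))"
      proof (rule plan_reward[OF dec Q])
        show "s u (history_of y as) = Open j"
          if "decode u = a" "[] @ fst a = as @ j # bs" "\<And>i. i \<in> set as \<Longrightarrow> y i \<le> \<zeta> i" for u y as j bs
        proof -
          have "a = (as @ j # bs, snd a)" using that(2) by (simp add: prod_eq_iff)
          then show ?thesis
            unfolding s that(1) using plan_rule_open[of as y \<zeta> j bs "snd a"] that(3) by metis
        qed
        show "s u (history_of y ([] @ fst a)) = Stop (snd a)"
          if "decode u = a" "\<And>i. i \<in> set ([] @ fst a) \<Longrightarrow> y i \<le> \<zeta> i" for u y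
          unfolding s that(1) using plan_rule_stop[of "fst a" y \<zeta> "snd a"] that(2) ok by simp
      qed (use ok in simp)
      then show ?thesis using al prob[OF a] by simp
    qed
    have "(LINT w|\<Omega>. reward \<gamma> w) = (LINT w|\<Omega>. (\<Sum>a\<in>?P. of_bool (decode (fst w) = a) * reward \<gamma> w))"
      by (intro Bochner_Integration.integral_cong refl split)
    also have "\<dots> = (\<Sum>a\<in>?P. LINT w|\<Omega>. of_bool (decode (fst w) = a) * reward \<gamma> w)"
      by (intro Bochner_Integration.integral_sum integrable_event Q')
    also have "\<dots> = (\<Sum>a\<in>?P. pmf q a * (\<gamma> \<bullet> plan_vec hit (snd a) [] (fst a)))"
      by (intro sum.cong refl plan)
    finally show ?thesis unfolding \<sigma> behavior_inner by (simp add: inner_sum_right)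
  qed
  then show ?thesis using vector_eq_ldot by blast
qed

text \<open>All capped values equal \<open>z\<close> almost surely, so any choice attains their
  maximum; the other part of the slack vanishes by \<open>plan_rule_unchosen\<close>.\<close>

lemma plan_mixture_optimal:
  assumes z: "\<And>i. \<zeta> i = z" and low: "\<And>i. AE x in F i. z \<le> x"
  shows "optimal_strategy c F (plan_mixture \<zeta> q)" and "kappa_mean = z"
proof -
  let ?\<sigma> = "plan_mixture \<zeta> q"
  define U where "U = fst ?\<sigma>" define s where "s = snd ?\<sigma>"
  have \<sigma>: "?\<sigma> = (U, s)" by (simp add: U_def s_def)
  have s: "s u = plan_rule \<zeta> (decode u)" for u by (simp add: s_def plan_mixture_def)
  interpret search F c \<zeta> U s
    by unfold_locales (use plan_mixture_strategy[of \<zeta> q] \<sigma> in simp)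
  have "AE w in \<Omega>. z \<le> snd w i" for i by (rule AE_value[OF low]) simp
  then have ae: "AE w in \<Omega>. \<forall>i. z \<le> snd w i" by (simp add: AE_all_countable)
  have K: "kappa_max \<zeta> y = z" if "\<forall>i. z \<le> y i" for y
    using kappa_max_attained[of \<zeta> y] that by (auto simp: z min_absorb2)
  have "AE w in \<Omega>. slack \<zeta> (s (fst w)) (snd w) = 0"
    using ae
  proof eventually_elim
    case (elim w)
    have "(\<Sum>i\<in>set (op w) - {ch w}. max (snd w i - \<zeta> i) 0) = 0"
      using plan_rule_unchosen[OF decode_plans, of _ \<zeta> "fst w" "snd w"] by (intro sum.neutral) (auto simp: s)
    then show ?case using elim K[of "snd w"] by (simp add: slack_def z min_absorb2)
  qed
  then show "optimal_strategy c F ?\<sigma>"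
    using strategy payoff_eq_iff by (simp add: optimal_strategy_iff \<sigma>)
  have "(LINT w|\<Omega>. kappa_max \<zeta> (snd w)) = (LINT w|\<Omega>. z)"
  proof (rule integral_cong_AE)
    show "AE w in \<Omega>. kappa_max \<zeta> (snd w) = z" using ae by eventually_elim (rule K)
  qed auto
  then show "kappa_mean = z" using integral_kappa_max Om.prob_space by simp
qed

end

subsection \<open>Polytopes and the main theorem\<close>

lemma vertex_of_imp_extreme_point:
  assumes "vertex_of s S"
  shows "s extreme_point_of S"
  unfolding extreme_point_of_def
proof (intro conjI ballI notI)
  obtain f :: "'a \<Rightarrow> real" where f: "linear f" "\<And>t. t \<in> S \<Longrightarrow> t \<noteq> s \<Longrightarrow> f t < f s"
    using assms by (auto simp: vertex_of_def)
  fix a b assume ab: "a \<in> S" "b \<in> S" "s \<in> open_segment a b"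
  then obtain u where u: "0 < u" "u < 1" "s = (1 - u) *\<^sub>R a + u *\<^sub>R b"
    by (auto simp: in_segment)
  have ne: "a \<noteq> s" "b \<noteq> s" using ab(3) by (auto simp: open_segment_def)
  have "f s = (1 - u) * f a + u * f b"
    unfolding u(3) using f(1) by (simp add: linear_add linear_scale)
  also have "\<dots> < (1 - u) * f s + u * f s"
    using u f(2)[OF ab(1) ne(1)] f(2)[OF ab(2) ne(2)] by (intro add_strict_mono mult_strict_left_mono) auto
  finally show False by (simp add: algebra_simps)
qed (use assms in \<open>simp add: vertex_of_def\<close>)

text \<open>Faces of a polyhedron are exposed, so its extreme points are vertices, and a polytope is
  the hull of its finitely many extreme points.\<close>

lemma vertex_polytope_convex_hull:
  fixes W :: "'a::euclidean_space set"
  assumes "finite W"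
  shows "vertex_polytope (convex hull W)"
proof -
  let ?S = "convex hull W"
  have poly: "polyhedron ?S" using assms by (intro polytope_imp_polyhedron polytope_convex_hull)
  have "vertex_of x ?S" if "x extreme_point_of ?S" for x
  proof -
    have "{x} exposed_face_of ?S" using that poly by (simp add: exposed_face_of_polyhedron face_of_singleton)
    then obtain a b where a: "?S \<subseteq> {y. a \<bullet> y \<le> b}" "{x} = ?S \<inter> {y. a \<bullet> y = b}"
      unfolding exposed_face_of_def by blast
    then have "x \<in> ?S" "a \<bullet> x = b" by blast+
    moreover have "a \<bullet> t < b" if "t \<in> ?S" "t \<noteq> x" for t
      using a that by (intro order_neq_le_trans) blast+
    moreover have "linear (\<lambda>t. a \<bullet> t)"
      by (rule bounded_linear.linear[OF bounded_linear_inner_right])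
    ultimately show ?thesis unfolding vertex_of_def by metis
  qed
  then have eq: "{x. vertex_of x ?S} = {x. x extreme_point_of ?S}"
    using vertex_of_imp_extreme_point by blast
  have "finite {x. x extreme_point_of ?S}"
    using finite_subset[OF extreme_points_of_convex_hull assms] .
  then show ?thesis
    using Krein_Milman_polytope[OF assms] by (simp add: vertex_polytope_def eq)
qed

text \<open>Different plans may have the same vector, so the convex weights live on the image; they
  are pulled back by picking one preimage of each vector.\<close>

lemma convex_hull_image_pmf:
  fixes g :: "'b \<Rightarrow> 'a::euclidean_space"
  assumes "finite P" "x \<in> convex hull (g ` P)"
  obtains q where "set_pmf q \<subseteq> P" "x = (\<Sum>a\<in>P. pmf q a *\<^sub>R g a)"
proof -
  let ?W = "g ` P"
  obtain u where u: "\<And>w. w \<in> ?W \<Longrightarrow> 0 \<le> u w" "sum u ?W = 1" "(\<Sum>w\<in>?W. u w *\<^sub>R w) = x"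
    using assms by (auto simp: convex_hull_finite)
  define f where "f w = (if w \<in> ?W then u w else 0)" for w
  define r where "r = embed_pmf f"
  have f0: "0 \<le> f w" for w using u(1) by (simp add: f_def)
  have "(\<integral>\<^sup>+w. ennreal (f w) \<partial>count_space UNIV) = (\<Sum>w\<in>?W. ennreal (f w))"
    using assms(1) by (intro nn_integral_count_space') (auto simp: f_def)
  also have "\<dots> = ennreal (\<Sum>w\<in>?W. f w)" by (rule sum_ennreal) (rule f0)
  also have "\<dots> = 1" using u(2) by (simp add: f_def)
  finally have r: "pmf r w = f w" for w
    unfolding r_def by (rule pmf_embed_pmf[OF f0])
  have rW: "set_pmf r \<subseteq> ?W" by (auto simp: set_pmf_iff r f_def split: if_splits)
  let ?h = "inv_into P g"
  show ?thesis
  proof (rule that)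
    show sub: "set_pmf (map_pmf ?h r) \<subseteq> P" using rW inv_into_into[of _ g P] by fastforce
    have "(\<Sum>a\<in>P. pmf (map_pmf ?h r) a *\<^sub>R g a) = (LINT a|measure_pmf (map_pmf ?h r). g a)"
      using sub assms(1) by (intro integral_measure_pmf[symmetric]) auto
    also have "\<dots> = (LINT w|measure_pmf r. g (?h w))" by (rule integral_map_pmf)
    also have "\<dots> = (\<Sum>w\<in>?W. pmf r w *\<^sub>R g (?h w))"
      using rW assms(1) by (intro integral_measure_pmf) auto
    also have "\<dots> = (\<Sum>w\<in>?W. u w *\<^sub>R w)"
      by (intro sum.cong refl) (simp add: r f_def f_inv_into_f)
    finally show "x = (\<Sum>a\<in>P. pmf (map_pmf ?h r) a *\<^sub>R g a)" using u(3) by simp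
  qed
qed

lemma distribution_on_mono: "distribution_on M a b \<Longrightarrow> a' \<le> a \<Longrightarrow> b \<le> b' \<Longrightarrow> distribution_on M a' b'"
  unfolding distribution_on_def by (auto elim: eventually_mono)

theorem theorem2:
  fixes F0 :: "'n::finite \<Rightarrow> real measure"
    and xlo xhi c :: "'n \<Rightarrow> real"
    and z :: real
  assumes "CARD('n) \<ge> 2"
    and "\<And>i. 0 \<le> xlo i" and "\<And>i. xlo i < xhi i" and "\<And>i. xhi i \<le> 1"
    and "\<And>i. distribution_on (F0 i) (xlo i) (xhi i)"
    and "\<And>i. 0 < c i" and "\<And>i. c i < mean (F0 i) - xlo i"
    and "\<And>i. mean (F0 i) - c i = z"
  shows "vertex_polytope (feasible_pairs xlo xhi F0 c) \<and>
    (\<exists>Fstar. feasible_profile xlo xhi F0 Fstar \<and>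
      (\<forall>p \<in> feasible_pairs xlo xhi F0 c. induces c Fstar p) \<and>
      (\<forall>i. reservation_value (c i) (Fstar i) = z) \<and>
      (\<forall>F. feasible_profile xlo xhi F0 F \<longrightarrow> optimal_payoff c Fstar \<le> optimal_payoff c F) \<and>
      optimal_payoff c Fstar = z)"
proof -
  note dist0 = assms(5)
  have c_eq: "c i = mean (F0 i) - z" for i using assms(8)[of i] by simp
  \<comment> \<open>The bound on the cost gives \<open>xlo i \<le> z\<close>, which places the lower
    atom of the two-point law in the support.\<close>
  have z: "xlo i \<le> z" "z < mean (F0 i)" "z \<le> xhi i" "0 \<le> z" for i
    using assms(2,6,7,8)[of i] mean_bounds[OF dist0[of i]] by linarith+
  define p where "p i = success_prob (F0 i) (xhi i) z" for i
  have p: "0 < p i" "p i \<le> 1" for i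
    unfolding p_def using success_prob_pos[OF dist0 z(2)] success_prob_le_1[OF dist0 z(2)] by auto
  define Fs where "Fs i = two_point (p i) z (z + c i / p i)" for i
  define g where "g a = plan_vec p (snd a) [] (fst a)" for a :: "'n list \<times> 'n"
  let ?P = "plans [] :: ('n list \<times> 'n) set"

  \<comment> \<open>The means are preserved, so every feasible profile has cutoffs at or above
    \<open>z\<close>, and \<open>p\<close>, which depends on the priors only, bounds its success
    probabilities from below.\<close>
  have problem: "\<exists>\<zeta>. search_problem F c \<zeta> \<and> (\<forall>i. p i \<le> measure (F i) {\<zeta> i<..})"
    if feas: "feasible_profile xlo xhi F0 F" for F
  proof -
    have mpc: "mean_preserving_contraction (xlo i) (xhi i) (F0 i) (F i)" for i
      using feas by (simp add: feasible_profile_def)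
    have d: "distribution_on (F i) (xlo i) (xhi i)" and m: "mean (F i) = mean (F0 i)" for i
      using mpc[of i] assms(3)[of i] mean_preserving_contraction_iff[OF dist0[of i]] by auto
    have "\<exists>\<zeta>. z \<le> \<zeta> \<and> \<zeta> \<le> xhi i \<and> c i = (LINT x|F i. max (x - \<zeta>) 0)" for i
      using reservation_value_exists[OF d[of i], of "c i" z] z(3)[of i] assms(6)[of i]
      by (auto simp: c_eq m)
    then obtain \<zeta> where \<zeta>: "\<And>i. z \<le> \<zeta> i" "\<And>i. \<zeta> i \<le> xhi i"
      "\<And>i. c i = (LINT x|F i. max (x - \<zeta> i) 0)" by metis
    have "search_problem F c \<zeta>"
    proof
      show "distribution_on (F i) 0 1" for i
        using distribution_on_mono[OF d] assms(2,4) by blast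
      show "0 \<le> \<zeta> i" "\<zeta> i \<le> 1" for i
        using \<zeta>(1,2)[of i] z(4) assms(4)[of i] by auto
    qed (rule \<zeta>(3))
    moreover have "p i \<le> measure (F i) {\<zeta> i<..}" for i
      unfolding p_def using \<zeta>(3)[of i] success_prob_least[OF dist0 z(1,2) mpc \<zeta>(1)] by (simp add: c_eq)
    ultimately show ?thesis by blast
  qed

  have feas: "feasible_profile xlo xhi F0 Fs"
    unfolding feasible_profile_def Fs_def p_def c_eq
    using two_point_contraction[OF dist0 z(1,2)] by blast
  note two_point = two_point_reservation[OF p assms(6)]
  have res: "c i = (LINT y|Fs i. max (y - z) 0)" "reservation_value (c i) (Fs i) = z"
    "measure (Fs i) {z<..} = p i" for i
    unfolding Fs_def by (rule two_point)+
  have Fs: "search_problem Fs c (\<lambda>_. z)"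
  proof
    obtain \<zeta> where "search_problem Fs c \<zeta>" using problem[OF feas] by blast
    then show "distribution_on (Fs i) 0 1" for i by (rule search_problem.dist)
    show "z \<le> 1" using z(3) assms(4) order_trans by blast
  qed (fact res(1) z(4))+
  have low: "AE x in Fs i. z \<le> x" for i
    unfolding Fs_def using p[of i] assms(6)[of i] by (intro AE_two_point) auto
  interpret Fs: search_problem Fs c "\<lambda>_. z" by (rule Fs)

  have subset: "feasible_pairs xlo xhi F0 c \<subseteq> convex hull (g ` ?P)"
  proof
    fix x assume "x \<in> feasible_pairs xlo xhi F0 c"
    then obtain F \<sigma> where F: "feasible_profile xlo xhi F0 F" and opt: "optimal_strategy c F \<sigma>"
      and x: "x = (search_behavior F \<sigma>, choice_behavior F \<sigma>)"
      by (auto simp: feasible_pairs_def induces_def)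
    obtain \<zeta> where sp: "search_problem F c \<zeta>" and hit: "\<And>i. p i \<le> measure (F i) {\<zeta> i<..}"
      using problem[OF F] by blast
    interpret F: search_problem F c \<zeta> by (rule sp)
    obtain U s where \<sigma>: "\<sigma> = (U, s)" by (cases \<sigma>)
    interpret search F c \<zeta> U s
      by unfold_locales (use opt \<sigma> in \<open>simp add: optimal_strategy_def\<close>)
    have dec: decisive
      using opt payoff_eq_iff p(1) hit by (intro decisiveI) (auto simp: F.optimal_strategy_iff \<sigma> intro: less_le_trans)
    show "x \<in> convex hull (g ` ?P)"
    proof (rule ccontr)
      assume "x \<notin> convex hull (g ` ?P)"
      moreover have "closed (convex hull (g ` ?P))"
        by (intro compact_imp_closed finite_imp_compact_convex_hull finite_imageI finite_plans)
      ultimately obtain \<gamma> b where \<gamma>: "\<gamma> \<bullet> x < b" "\<And>y. y \<in> convex hull (g ` ?P) \<Longrightarrow> b < \<gamma> \<bullet> y"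
        using separating_hyperplane_closed_point[OF convex_convex_hull] by metis
      \<comment> \<open>The separation puts \<open>x\<close> strictly below the hull, whereas
        \<open>behavior_le_plan\<close> bounds from above; hence the sign.\<close>
      obtain a where a: "a \<in> ?P" "(- \<gamma>) \<bullet> x \<le> (- \<gamma>) \<bullet> g a"
        using behavior_le_plan[OF dec p hit, of "- \<gamma>"] unfolding x \<sigma> g_def by fastforce
      then have "b < \<gamma> \<bullet> g a" using \<gamma>(2) by (simp add: hull_inc)
      with a(2) \<gamma>(1) show False by simp
    qed
  qed
  have induced: "induces c Fs x" if "x \<in> convex hull (g ` ?P)" for x
  proof -
    obtain q where q: "set_pmf q \<subseteq> ?P" "x = (\<Sum>a\<in>?P. pmf q a *\<^sub>R g a)"
      using convex_hull_image_pmf[OF finite_plans \<open>x \<in> _\<close>] by blast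
    have "x = (search_behavior Fs (plan_mixture (\<lambda>_. z) q), choice_behavior Fs (plan_mixture (\<lambda>_. z) q))"
      unfolding Fs.plan_mixture_behavior[OF q(1)] q(2) g_def by (simp add: res(3))
    then show ?thesis
      unfolding induces_def using Fs.plan_mixture_optimal(1)[OF refl low] by blast
  qed
  have "feasible_pairs xlo xhi F0 c = convex hull (g ` ?P)"
    using subset induced feas unfolding feasible_pairs_def by blast
  then have poly: "vertex_polytope (feasible_pairs xlo xhi F0 c)"
    by (simp add: vertex_polytope_convex_hull finite_plans)
  have val: "optimal_payoff c Fs = z"
    using Fs.optimal_payoff_eq Fs.plan_mixture_optimal(2)[OF refl low] by simp
  have "z \<le> optimal_payoff c F" if F: "feasible_profile xlo xhi F0 F" for F
  proof -
    obtain \<zeta> where sp: "search_problem F c \<zeta>" using problem[OF F] by blast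
    interpret F: search_problem F c \<zeta> by (rule sp)
    have "mean (F i) = mean (F0 i)" for i
      using F assms(3)[of i] mean_preserving_contraction_iff[OF dist0[of i]]
      by (auto simp: feasible_profile_def)
    \<comment> \<open>Any one box gives the bound; \<open>undefined\<close> merely names
      one.\<close>
    then show ?thesis using F.mean_minus_cost_le[of undefined] F.optimal_payoff_eq assms(8) by simp
  qed
  then show ?thesis
    using poly feas subset induced res(2) val by (intro conjI exI[of _ Fs]) auto
qed

end
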